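(* Let $n\ge 2$, $R>0$, and let $(B_R,g)$ be the ball of radius $R$ in $\mathbb{R}^n$ centered at $p$ with rotationally invariant metric $g=dr^2+\sigma^2(r)\,du^2$, where $du^2$ is the standard metric on $\mathbb{S}^{n-1}$ and $\sigma:[0,R]\to[0,\infty)$ is smooth with $\sigma(0)=0$, $\sigma'(0)=1$, $\sigma(r)>0$ for $r\in(0,R]$. Let $K(r)=-\sigma''(r)/\sigma(r)$ be its radial curvature. Let $k\in\mathbb{R}$ (with $R<\pi/\sqrt{k}$ if $k>0$) and let $(B_R,\mathrm{can}_k)$ be the same ball with metric $\mathrm{can}_k=dr^2+\sin_k^2(r)\,du^2$. Then: (i) if $K(r)\ge k$ for all $r\in(0,R]$, then $$\mu_1(B_R,\mathrm{can}_k)\le\mu_1(B_R,g)\le\Big(\frac{\sin_k R}{\sigma(R)}\Big)^{n+1}\mu_1(B_R,\mathrm{can}_k);$$ (ii) if $K(r)\le k$ for all $r\in(0,R]$, then $$\Big(\frac{\sin_k R}{\sigma(R)}\Big)^{n+1}\mu_1(B_R,\mathrm{can}_k)\le\mu_1(B_R,g)\le\mu_1(B_R,\mathrm{can}_k).$$ Furthermore, equality holds (throughout) if and only if $\sigma(r)=\sin_k r$ for all $r\in[0,R]$, i.e. $(B_R,g)$ is isometric to $(B_R,\mathrm{can}_k)$.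
   Context: $\sin_k r = r$ if $k=0$; $\sin_k r=\sin(\sqrt{k}\,r)/\sqrt{k}$ if $k>0$; $\sin_k r=\sinh(\sqrt{-k}\,r)/\sqrt{-k}$ if $k<0$. The radial curvature $K(r)=-\sigma''(r)/\sigma(r)$ is the sectional curvature of planes spanned by $\nabla r$ and a unit vector orthogonal to it. $\mu_1$ denotes the first non-zero eigenvalue of the Steklov problem $\Delta f=0$ in $B_R$, $\partial f/\partial\nu=\mu f$ on $\partial B_R$ ($\nu$ the unit outward normal), characterized variationally by $\mu_1=\inf\{\int_{B_R}\|\nabla u\|^2\,dv/\int_{\partial B_R}u^2\,ds:\ \int_{\partial B_R}u\,ds=0,\ 0\ne u\in C^1(\overline{B_R})\}$, with all quantities computed in the respective metric. *)

theory Defs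
  imports "HOL-Analysis.Analysis"
begin

definition sin_k :: "real \<Rightarrow> real \<Rightarrow> real" where
  "sin_k k r = (if k = 0 then r
                else if k > 0 then sin (sqrt k * r) / sqrt k
                else sinh (sqrt (- k) * r) / sqrt (- k))"

text \<open>The ball B_R in R^n (Cartesian coordinates centred at p = 0) carries the metric
  dr^2 + s(r)^2 du^2.  Writing r = |x| and a(x) = s(r)/r, in Cartesian coordinates
  g_ij = a^2 delta_ij + (1 - a^2) x_i x_j / r^2, so for a function u with Euclidean
  gradient G:  |grad_g u|^2 = |G|^2/a^2 + (1 - 1/a^2) (x.G/r)^2  and  dv_g = a^(n-1) dx.\<close>

definition metric_grad_sq :: "(real \<Rightarrow> real) \<Rightarrow> real^'n \<Rightarrow> real^'n \<Rightarrow> real" where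
  "metric_grad_sq s x G =
     (let r = norm x; a = s r / r
      in (norm G)^2 / a^2 + (1 - 1 / a^2) * ((x \<bullet> G) / r)^2)"

definition metric_vol_density :: "(real \<Rightarrow> real) \<Rightarrow> real^'n \<Rightarrow> real" where
  "metric_vol_density s x = (s (norm x) / norm x) ^ (CARD('n) - 1)"

definition dirichlet_energy :: "(real \<Rightarrow> real) \<Rightarrow> real \<Rightarrow> (real^'n \<Rightarrow> real^'n) \<Rightarrow> real" where
  "dirichlet_energy s R G =
     integral (ball 0 R) (\<lambda>x. metric_grad_sq s x (G x) * metric_vol_density s x)"

text \<open>Integral over the unit sphere S^(n-1) w.r.t. its standard measure, via
  \<integral>_{S^(n-1)} f = n \<integral>_{B_1} f(x/|x|) dx.\<close>
definition unit_sphere_integral :: "(real^'n \<Rightarrow> real) \<Rightarrow> real" where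
  "unit_sphere_integral f = real CARD('n) * integral (ball 0 1) (\<lambda>x. f (x /\<^sub>R norm x))"

text \<open>Boundary integral \<integral>_{\<partial>B_R} f ds_g; on \<partial>B_R the induced metric is s(R)^2 du^2.\<close>
definition boundary_integral :: "(real \<Rightarrow> real) \<Rightarrow> real \<Rightarrow> (real^'n \<Rightarrow> real) \<Rightarrow> real" where
  "boundary_integral s R f = s R ^ (CARD('n) - 1) * unit_sphere_integral (\<lambda>w. f (R *\<^sub>R w))"

definition C1_cball_grad :: "real \<Rightarrow> (real^'n \<Rightarrow> real) \<Rightarrow> (real^'n \<Rightarrow> real^'n) \<Rightarrow> bool" where
  "C1_cball_grad R u G \<longleftrightarrow>
     (\<forall>x\<in>cball 0 R. (u has_derivative (\<lambda>h. G x \<bullet> h)) (at x within cball 0 R))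
     \<and> continuous_on (cball 0 R) G"

text \<open>First nonzero Steklov eigenvalue, variational characterisation.  Functions with
  vanishing boundary integral of u^2 give quotient +\<infinity> and do not affect the infimum,
  so they are omitted (avoiding Isabelle's x/0 = 0).\<close>
definition steklov_mu1 :: "(real \<Rightarrow> real) \<Rightarrow> real \<Rightarrow> 'n::finite itself \<Rightarrow> real" where
  "steklov_mu1 s R _ = Inf {dirichlet_energy s R G / boundary_integral s R (\<lambda>x. (u x)^2) | u G.
       C1_cball_grad R (u :: real^'n \<Rightarrow> real) G \<and> boundary_integral s R u = 0 \<and>
       boundary_integral s R (\<lambda>x. (u x)^2) \<noteq> 0}"

end

(* Writing a test function u in polar coordinates, its Rayleigh quotient for dr^2 + s(r)^2 du^2 is
     int ( u_r^2 (s(r)/s(R))^(n-1) + |grad_S u|^2 s(r)^(n-3)/s(R)^(n-1) ) / int u(R,.)^2,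
   and the set of admissible u does not depend on s.  If the curvature of s is at least that of t,
   the Wronskian shows that s/t is nonincreasing and at most 1, so both weights for s lie between
   those for t and (t(R)/s(R))^(n+1) times those for t, pointwise; taking infima gives both
   inequalities, with no need to know the eigenfunctions.

   For the equality case, mu_1 > 0 forces s(R) = t(R), hence s/t = 1 throughout.  Positivity of mu_1
   is a trace-Poincare inequality on the unit ball: with g(x) = u(x/|x|), x in the annulus
   1/2 <= |x| < 1 and y in the ball,
     (g(x) - u(y))^2 <= 2 (g(x) - u(x))^2 + 2 (u(x) - u(y))^2,
   and both terms on the right are integrals of grad u along segments, bounded by Tonelli and
   affine changes of variables. *)

theory Submission
  imports Defs
begin

text \<open>The exponent n+1 is (n-1) + 2: the power n-1 comes from normalising by the boundary
  volume s(R)^(n-1), and the 2 from the angular part, where the gradient carries an inverse square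
  of s. That part is the delicate one, since s enters it with exponent n-3, which is negative for n
  = 2; the bound s <= t alone does not control it there, and monotonicity of s/t has to absorb one
  inverse factor. Part (ii) is part (i) with the two warping functions exchanged, so the comparison
  is proved for two arbitrary profiles s and t. Positivity of mu_1 needs an explicit lower bound,
  because no minimiser is at hand. The sphere is a null set of the ball, so traces are handled
  through the extension x/|x|, which is also how the sphere integral is defined. The annulus |x| >=
  1/2 keeps the stretching 1/|x| along rays at most 2. The increments are integrated in extended
  nonnegative form, where Tonelli asks only for measurability.\<close>

subsection \<open>Increments along segments\<close>

text \<open>Cauchy-Schwarz for the integral of \<open>\<phi>'\<close>, got by integrating the square
  of \<open>(b - a) * \<phi>' t - d\<close>, where \<open>d\<close> is the increment. The expansion
  has a spare factor \<open>b - a\<close>, so the degenerate interval is split off.\<close>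

lemma square_increment_le:
  fixes \<phi> \<phi>' :: "real \<Rightarrow> real"
  assumes ab: "a \<le> b"
    and der: "\<And>t. t \<in> {a..b} \<Longrightarrow> (\<phi> has_real_derivative \<phi>' t) (at t within {a..b})"
    and cont: "continuous_on {a..b} \<phi>'"
  shows "(\<phi> b - \<phi> a)\<^sup>2 \<le> (b - a) * integral {a..b} (\<lambda>t. (\<phi>' t)\<^sup>2)"
proof (cases "a = b")
  case False
  define d where "d = \<phi> b - \<phi> a"
  define J where "J = integral {a..b} (\<lambda>t. (\<phi>' t)\<^sup>2)"
  have 1: "(\<phi>' has_integral d) {a..b}"
    unfolding d_def
    by (rule fundamental_theorem_of_calculus[OF ab])
      (use der in \<open>simp add: has_real_derivative_iff_has_vector_derivative\<close>)
  have 2: "((\<lambda>t. (\<phi>' t)\<^sup>2) has_integral J) {a..b}"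
    unfolding J_def
    by (intro integrable_integral integrable_continuous_interval continuous_intros cont)
  have 3: "((\<lambda>t. d\<^sup>2) has_integral (b - a) * d\<^sup>2) {a..b}"
    using has_integral_const_real[of "d\<^sup>2" a b] ab by simp
  have "((\<lambda>t. (b - a)\<^sup>2 * (\<phi>' t)\<^sup>2 - (2 * (b - a) * d) * \<phi>' t + d\<^sup>2) has_integral
      (b - a)\<^sup>2 * J - (2 * (b - a) * d) * d + (b - a) * d\<^sup>2) {a..b}"
    by (intro has_integral_add has_integral_diff has_integral_mult_right 1 2 3)
  moreover have "(b - a)\<^sup>2 * (\<phi>' t)\<^sup>2 - (2 * (b - a) * d) * \<phi>' t + d\<^sup>2 \<ge> 0" for t
  proof -
    have "0 \<le> ((b - a) * \<phi>' t - d)\<^sup>2" by simp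
    then show ?thesis by (simp add: power2_eq_square algebra_simps)
  qed
  ultimately have "0 \<le> (b - a)\<^sup>2 * J - (2 * (b - a) * d) * d + (b - a) * d\<^sup>2"
    by (rule has_integral_nonneg)
  also have "\<dots> = (b - a) * ((b - a) * J - d\<^sup>2)"
    by (simp add: power2_eq_square algebra_simps)
  finally show ?thesis
    using ab False by (simp add: zero_le_mult_iff J_def d_def)
qed simp

text \<open>The form in \<open>ennreal\<close> over all of \<open>lborel\<close>, with the interval
  as an indicator, is the one to which Tonelli applies later.\<close>

lemma ennreal_square_increment_le:
  fixes \<phi> \<phi>' :: "real \<Rightarrow> real"
  assumes ab: "a \<le> b"
    and der: "\<And>t. t \<in> {a..b} \<Longrightarrow> (\<phi> has_real_derivative \<phi>' t) (at t within {a..b})"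
    and cont: "continuous_on {a..b} \<phi>'"
  shows "ennreal ((\<phi> b - \<phi> a)\<^sup>2) \<le>
    ennreal (b - a) * (\<integral>\<^sup>+t. ennreal ((\<phi>' t)\<^sup>2) * indicator {a..b} t \<partial>lborel)"
proof -
  have int: "((\<lambda>t. (\<phi>' t)\<^sup>2) has_integral integral {a..b} (\<lambda>t. (\<phi>' t)\<^sup>2)) {a..b}"
    by (intro integrable_integral integrable_continuous_interval continuous_intros cont)
  have "(\<integral>\<^sup>+t. ennreal (indicator {a..b} t * (\<phi>' t)\<^sup>2) \<partial>lborel) =
      ennreal (integral {a..b} (\<lambda>t. (\<phi>' t)\<^sup>2))"
  proof (rule nn_integral_has_integral_lborel)
    show "(\<lambda>t. indicator {a..b} t * (\<phi>' t)\<^sup>2) \<in> borel_measurable borel"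
      using borel_measurable_continuous_on_indicator[of "{a..b}" "\<lambda>t. (\<phi>' t)\<^sup>2"] cont
      by (simp add: continuous_intros)
    show "((\<lambda>t. indicator {a..b} t * (\<phi>' t)\<^sup>2) has_integral
        integral {a..b} (\<lambda>t. (\<phi>' t)\<^sup>2)) UNIV"
    proof -
      have "indicator {a..b} t * (\<phi>' t)\<^sup>2 = (if t \<in> {a..b} then (\<phi>' t)\<^sup>2 else 0)" for t
        by simp
      then show ?thesis
        using int has_integral_restrict_UNIV[of "{a..b}" "\<lambda>t. (\<phi>' t)\<^sup>2"] by presburger
    qed
  qed auto
  moreover have "ennreal (indicator {a..b} t * (\<phi>' t)\<^sup>2) = ennreal ((\<phi>' t)\<^sup>2) * indicator {a..b} t" for t
    by (simp add: indicator_def)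
  ultimately have "(\<integral>\<^sup>+t. ennreal ((\<phi>' t)\<^sup>2) * indicator {a..b} t \<partial>lborel) =
      ennreal (integral {a..b} (\<lambda>t. (\<phi>' t)\<^sup>2))" by simp
  then show ?thesis
    using square_increment_le[OF assms] ab
    by (simp add: ennreal_mult'[symmetric] ennreal_leI)
qed

text \<open>The factor is the inverse Jacobian of the dilation. Dilation by \<open>c \<ge> 1\<close>
  can only lower the integral, and by \<open>c \<ge> 1/2\<close> it raises it by a factor of at most
  \<open>2 ^ DIM('a)\<close>; the increment estimates rest on these two cases.\<close>

lemma nn_integral_lborel_affine:
  fixes h :: "'a::euclidean_space \<Rightarrow> ennreal"
  assumes [measurable]: "h \<in> borel_measurable borel" and c: "c > 0"
  shows "(\<integral>\<^sup>+x. h (z + c *\<^sub>R x) \<partial>lborel) = ennreal (1 / c ^ DIM('a)) * (\<integral>\<^sup>+x. h x \<partial>lborel)"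
proof -
  have "(\<integral>\<^sup>+x. h x \<partial>lborel) = (\<integral>\<^sup>+x. h x \<partial>density (distr lborel borel (\<lambda>x. z + c *\<^sub>R x)) (\<lambda>_. \<bar>c\<bar> ^ DIM('a)))"
    using lborel_affine[of c z] c by simp
  also have "\<dots> = ennreal (c ^ DIM('a)) * (\<integral>\<^sup>+x. h (z + c *\<^sub>R x) \<partial>lborel)"
    using c by (simp add: nn_integral_density nn_integral_distr nn_integral_cmult)
  finally show ?thesis
    using c by (simp add: mult.assoc[symmetric] ennreal_mult'[symmetric])
qed

text \<open>Cut off to zero outside the closed ball, since \<open>G\<close> is arbitrary there. The
  result is Borel on the whole space for continuous \<open>G\<close>, so its dilates and translates
  can be integrated without tracking domains.\<close>

definition grad_density :: "real \<Rightarrow> (real^'n \<Rightarrow> real^'n) \<Rightarrow> real^'n \<Rightarrow> ennreal" where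
  "grad_density R G x = ennreal ((norm (G x))\<^sup>2) * indicator (cball 0 R) x"

lemma borel_measurable_grad_density [measurable]:
  assumes "C1_cball_grad R v G"
  shows "grad_density R G \<in> borel_measurable borel"
proof -
  have "(\<lambda>x. indicator (cball 0 R) x *\<^sub>R (norm (G x))\<^sup>2) \<in> borel_measurable borel"
    using assms unfolding C1_cball_grad_def
    by (intro borel_measurable_continuous_on_indicator continuous_intros) auto
  moreover have "grad_density R G = (\<lambda>x. ennreal (indicator (cball 0 R) x *\<^sub>R (norm (G x))\<^sup>2))"
    by (auto simp: grad_density_def indicator_def)
  ultimately show ?thesis
    using measurable_compose[OF _ measurable_ennreal] by (simp only:)
qed

text \<open>Cauchy-Schwarz enters twice: along the segment, and for the directional derivative
  \<open>G \<bullet> d\<close>, which gives \<open>(norm d)\<^sup>2\<close>. Base point and interval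
  are left free so that the lemma serves both rays from the origin (\<open>y = 0\<close>) and chords
  between two points.\<close>

lemma C1_segment_increment_le:
  assumes C1: "C1_cball_grad R v G" and ab: "a \<le> b"
    and seg: "\<And>t. t \<in> {a..b} \<Longrightarrow> y + t *\<^sub>R d \<in> cball 0 R"
  shows "ennreal ((v (y + b *\<^sub>R d) - v (y + a *\<^sub>R d))\<^sup>2) \<le>
    ennreal ((b - a) * (norm d)\<^sup>2) *
      (\<integral>\<^sup>+t. grad_density R G (y + t *\<^sub>R d) * indicator {a..b} t \<partial>lborel)"
proof -
  let ?p = "\<lambda>t. y + t *\<^sub>R d"
  have sub: "?p ` {a..b} \<subseteq> cball 0 R" using seg by blast
  have G: "continuous_on {a..b} (\<lambda>t. G (?p t))"
    by (rule continuous_on_compose2[of "cball 0 R" G])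
      (use C1 sub in \<open>auto simp: C1_cball_grad_def intro!: continuous_intros\<close>)
  have [measurable]: "grad_density R G \<in> borel_measurable borel"
    using C1 by measurable
  have "ennreal ((v (?p b) - v (?p a))\<^sup>2) \<le>
      ennreal (b - a) * (\<integral>\<^sup>+t. ennreal ((G (?p t) \<bullet> d)\<^sup>2) * indicator {a..b} t \<partial>lborel)"
  proof (rule ennreal_square_increment_le[OF ab])
    fix t assume t: "t \<in> {a..b}"
    have "(?p has_derivative (\<lambda>h. h *\<^sub>R d)) (at t within {a..b})"
      by (auto intro!: derivative_eq_intros)
    \<comment> \<open>\<open>C1_cball_grad\<close> gives a derivative relative to the closed ball
      only; it is restricted to the image of the segment for the chain rule.\<close>
    moreover have "(v has_derivative (\<lambda>h. G (?p t) \<bullet> h)) (at (?p t) within ?p ` {a..b})"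
      using C1 seg[OF t] sub has_derivative_subset unfolding C1_cball_grad_def by blast
    ultimately have "((\<lambda>t. v (?p t)) has_derivative (\<lambda>h. G (?p t) \<bullet> (h *\<^sub>R d))) (at t within {a..b})"
      by (rule has_derivative_in_compose)
    then show "((\<lambda>t. v (?p t)) has_real_derivative G (?p t) \<bullet> d) (at t within {a..b})"
      by (simp add: has_field_derivative_def mult.commute[of "G (?p t) \<bullet> d"] mult_commute_abs)
  next
    show "continuous_on {a..b} (\<lambda>t. G (?p t) \<bullet> d)"
      by (intro continuous_intros G)
  qed
  also have "\<dots> \<le> ennreal (b - a) * (\<integral>\<^sup>+t. ennreal ((norm d)\<^sup>2) * (grad_density R G (?p t) * indicator {a..b} t) \<partial>lborel)"
  proof (intro mult_left_mono nn_integral_mono)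
    fix t
    show "ennreal ((G (?p t) \<bullet> d)\<^sup>2) * indicator {a..b} t \<le>
        ennreal ((norm d)\<^sup>2) * (grad_density R G (?p t) * indicator {a..b} t)"
    proof (cases "t \<in> {a..b}")
      case True
      have "(G (?p t) \<bullet> d)\<^sup>2 \<le> (norm d)\<^sup>2 * (norm (G (?p t)))\<^sup>2"
        using power_mono[OF Cauchy_Schwarz_ineq2[of "G (?p t)" d] abs_ge_zero, of 2]
        by (simp add: power_mult_distrib mult.commute)
      then show ?thesis using True seg[OF True]
        by (simp add: grad_density_def ennreal_mult'[symmetric] ennreal_leI)
    qed simp
  qed simp
  also have "\<dots> = ennreal ((b - a) * (norm d)\<^sup>2) *
      (\<integral>\<^sup>+t. grad_density R G (?p t) * indicator {a..b} t \<partial>lborel)"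
    using ab by (subst nn_integral_cmult) (auto simp: ennreal_mult' mult.assoc)
  finally show ?thesis .
qed

text \<open>The point \<open>x\<close> moves along its ray to the sphere, with parameter from 1 to
  \<open>1 / norm x\<close>. On the annulus this stays within \<open>{1..2}\<close>, a range
  independent of \<open>x\<close>, so the order of integration can be exchanged. Each dilation by
  \<open>t \<ge> 1\<close> costs a factor of at most 1, and the range has length 1.\<close>

lemma nn_integral_radial_increment_le:
  fixes v :: "real^'n \<Rightarrow> real"
  assumes C1: "C1_cball_grad 1 v G"
  shows "(\<integral>\<^sup>+x. ennreal ((v (x /\<^sub>R norm x) - v x)\<^sup>2) * indicator (ball 0 1 - ball 0 (1/2)) x \<partial>lborel)
    \<le> (\<integral>\<^sup>+x. grad_density 1 G x \<partial>lborel)"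
proof -
  have [measurable]: "grad_density 1 G \<in> borel_measurable borel"
    using C1 by measurable
  have "(\<integral>\<^sup>+x. ennreal ((v (x /\<^sub>R norm x) - v x)\<^sup>2) * indicator (ball 0 1 - ball 0 (1/2)) x \<partial>lborel)
      \<le> (\<integral>\<^sup>+x. (\<integral>\<^sup>+t. grad_density 1 G (0 + t *\<^sub>R x) * indicator {1..2} t \<partial>lborel) \<partial>lborel)"
  proof (rule nn_integral_mono)
    fix x :: "real^'n"
    show "ennreal ((v (x /\<^sub>R norm x) - v x)\<^sup>2) * indicator (ball 0 1 - ball 0 (1/2)) x
      \<le> (\<integral>\<^sup>+t. grad_density 1 G (0 + t *\<^sub>R x) * indicator {1..2} t \<partial>lborel)"
    proof (cases "x \<in> ball 0 1 - ball 0 (1/2)")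
      case True
      then have r: "1/2 \<le> norm x" "norm x < 1" by auto
      then have ir: "1 \<le> 1 / norm x" "1 / norm x \<le> 2" by (auto simp: divide_simps)
      have "ennreal ((v (0 + (1 / norm x) *\<^sub>R x) - v (0 + 1 *\<^sub>R x))\<^sup>2) \<le>
        ennreal ((1 / norm x - 1) * (norm x)\<^sup>2) *
        (\<integral>\<^sup>+t. grad_density 1 G (0 + t *\<^sub>R x) * indicator {1..1 / norm x} t \<partial>lborel)"
      proof (rule C1_segment_increment_le[OF C1 ir(1)])
        fix t assume "t \<in> {1..1 / norm x}"
        moreover from this have "t * norm x \<le> (1 / norm x) * norm x"
          by (intro mult_right_mono) auto
        ultimately show "0 + t *\<^sub>R x \<in> cball 0 1"
          using r by (auto split: if_splits)
      qed
      also have "\<dots> \<le> 1 * (\<integral>\<^sup>+t. grad_density 1 G (0 + t *\<^sub>R x) * indicator {1..2} t \<partial>lborel)"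
      proof (intro mult_mono nn_integral_mono)
        have "(1 / norm x - 1) * (norm x)\<^sup>2 \<le> 1 * 1"
          using r ir by (intro mult_mono power_le_one) auto
        then show "ennreal ((1 / norm x - 1) * (norm x)\<^sup>2) \<le> 1"
          by (simp add: ennreal_le_1)
      qed (use ir in \<open>auto simp: indicator_def\<close>)
      finally show ?thesis using True by (simp add: inverse_eq_divide)
    qed simp
  qed
  also have "\<dots> = (\<integral>\<^sup>+t. (\<integral>\<^sup>+x. grad_density 1 G (0 + t *\<^sub>R x) * indicator {1..2} t \<partial>lborel) \<partial>lborel)"
    by (rule lborel_pair.Fubini') measurable
  also have "\<dots> \<le> (\<integral>\<^sup>+t. (\<integral>\<^sup>+x. grad_density 1 G x \<partial>lborel) * indicator {1..2::real} t \<partial>lborel)"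
  proof (rule nn_integral_mono)
    fix t :: real
    show "(\<integral>\<^sup>+x. grad_density 1 G (0 + t *\<^sub>R x) * indicator {1..2} t \<partial>lborel)
      \<le> (\<integral>\<^sup>+x. grad_density 1 G x \<partial>lborel) * indicator {1..2} t"
    proof (cases "t \<in> {1..2}")
      case True
      then have "1 / t ^ DIM(real^'n) \<le> 1" by (simp add: one_le_power)
      then have "ennreal (1 / t ^ DIM(real^'n)) * (\<integral>\<^sup>+x. grad_density 1 G x \<partial>lborel) \<le> 1 * (\<integral>\<^sup>+x. grad_density 1 G x \<partial>lborel)"
        by (intro mult_right_mono) (auto simp: ennreal_le_1)
      then show ?thesis
        using True nn_integral_lborel_affine[of "grad_density 1 G" t 0] by simp
    qed simp
  qed
  also have "\<dots> = (\<integral>\<^sup>+x. grad_density 1 G x \<partial>lborel)"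
    by (simp add: nn_integral_cmult)
  finally show ?thesis .
qed

text \<open>The factor 4 bounds \<open>(norm (x - y))\<^sup>2\<close> in the unit ball. With the
  segment parameter outermost, a change of variables in one endpoint costs at most
  \<open>2 ^ CARD('n)\<close> and leaves the integral of the density; the other endpoint contributes
  the volume of \<open>B\<close>.\<close>

lemma nn_integral_pair_increment_le:
  fixes v :: "real^'n \<Rightarrow> real"
  assumes C1: "C1_cball_grad 1 v G"
  defines "B \<equiv> ball 0 1 :: (real^'n) set"
  shows "(\<integral>\<^sup>+x. (\<integral>\<^sup>+y. ennreal ((v x - v y)\<^sup>2) * indicator B y \<partial>lborel) * indicator B x \<partial>lborel)
    \<le> ennreal (4 * 2 ^ CARD('n)) * emeasure lborel B * (\<integral>\<^sup>+x. grad_density 1 G x \<partial>lborel)"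
proof -
  define h where "h = grad_density 1 G"
  have h[measurable]: "h \<in> borel_measurable borel"
    unfolding h_def using C1 by measurable
  have B[measurable]: "B \<in> sets borel" unfolding B_def by simp
  define I where "I = (\<integral>\<^sup>+x. h x \<partial>lborel)"
  have scale: "(\<integral>\<^sup>+y. h (z + t *\<^sub>R y) \<partial>lborel) \<le> ennreal (2 ^ CARD('n)) * I" if "1/2 \<le> t" for t z
  proof -
    have "(1/2) ^ CARD('n) \<le> t ^ CARD('n)" using that by (intro power_mono) auto
    then have "1 / t ^ CARD('n) \<le> 2 ^ CARD('n)" using that by (simp add: field_simps)
    then show ?thesis
      using that nn_integral_lborel_affine[of h t z]
      by (auto simp: I_def intro!: mult_right_mono ennreal_leI)
  qed
  \<comment> \<open>All three domains enter as indicators, so every exchange of integrals takes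
    place over full spaces.\<close>
  define F where "F t x y = 4 * (h (y + t *\<^sub>R (x - y)) * indicator B x * indicator B y * indicator {0..1} t)"
    for t x y
  have "(\<integral>\<^sup>+x. (\<integral>\<^sup>+y. ennreal ((v x - v y)\<^sup>2) * indicator B y \<partial>lborel) * indicator B x \<partial>lborel)
    \<le> (\<integral>\<^sup>+x. (\<integral>\<^sup>+y. (\<integral>\<^sup>+t. F t x y \<partial>lborel) \<partial>lborel) \<partial>lborel)"
  proof (rule nn_integral_mono)
    fix x
    show "(\<integral>\<^sup>+y. ennreal ((v x - v y)\<^sup>2) * indicator B y \<partial>lborel) * indicator B x
      \<le> (\<integral>\<^sup>+y. (\<integral>\<^sup>+t. F t x y \<partial>lborel) \<partial>lborel)"
    proof (cases "x \<in> B")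
      case x: True
      have "ennreal ((v x - v y)\<^sup>2) * indicator B y \<le> (\<integral>\<^sup>+t. F t x y \<partial>lborel)" for y
      proof (cases "y \<in> B")
        case y: True
        have "ennreal ((v (y + 1 *\<^sub>R (x - y)) - v (y + 0 *\<^sub>R (x - y)))\<^sup>2) \<le>
          ennreal ((1 - 0) * (norm (x - y))\<^sup>2) *
          (\<integral>\<^sup>+t. grad_density 1 G (y + t *\<^sub>R (x - y)) * indicator {0..1} t \<partial>lborel)"
        proof (rule C1_segment_increment_le[OF C1])
          fix t :: real assume "t \<in> {0..1}"
          then have "(1 - t) *\<^sub>R y + t *\<^sub>R x \<in> cball 0 1"
            using x y by (intro convexD_alt[OF convex_cball]) (auto simp: B_def)
          then show "y + t *\<^sub>R (x - y) \<in> cball 0 1" by (simp add: algebra_simps)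
        qed simp
        also have "\<dots> \<le> 4 * (\<integral>\<^sup>+t. h (y + t *\<^sub>R (x - y)) * indicator {0..1} t \<partial>lborel)"
          unfolding h_def
        proof (rule mult_right_mono)
          have "norm (x - y) \<le> 2" using x y norm_triangle_ineq4[of x y] by (auto simp: B_def)
          then have "(norm (x - y))\<^sup>2 \<le> 2\<^sup>2" by (intro power_mono) auto
          then show "ennreal ((1 - 0) * (norm (x - y))\<^sup>2) \<le> 4"
            using ennreal_leI[of "(norm (x - y))\<^sup>2" 4] by simp
        qed simp
        also have "\<dots> = (\<integral>\<^sup>+t. F t x y \<partial>lborel)"
          using x y by (simp add: F_def nn_integral_cmult)
        finally show ?thesis using y by simp
      qed simp
      then show ?thesis using x by (simp add: nn_integral_mono)
    qed simp
  qed
  also have "\<dots> = (\<integral>\<^sup>+x. (\<integral>\<^sup>+t. (\<integral>\<^sup>+y. F t x y \<partial>lborel) \<partial>lborel) \<partial>lborel)"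
    by (intro nn_integral_cong lborel_pair.Fubini') (unfold F_def, measurable)
  also have "\<dots> = (\<integral>\<^sup>+t. (\<integral>\<^sup>+x. (\<integral>\<^sup>+y. F t x y \<partial>lborel) \<partial>lborel) \<partial>lborel)"
    by (intro lborel_pair.Fubini') (unfold F_def, measurable)
  also have "\<dots> \<le> (\<integral>\<^sup>+t. (4 * (ennreal (2 ^ CARD('n)) * I * emeasure lborel B)) * indicator {0..1::real} t \<partial>lborel)"
  proof (rule nn_integral_mono)
    fix t :: real
    show "(\<integral>\<^sup>+x. (\<integral>\<^sup>+y. F t x y \<partial>lborel) \<partial>lborel) \<le> (4 * (ennreal (2 ^ CARD('n)) * I * emeasure lborel B)) * indicator {0..1} t"
    proof (cases "t \<in> {0..1}")
      case t: True
      \<comment> \<open>Stated for free weights \<open>c\<close> and \<open>d\<close>, so that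
        either endpoint can be the inner variable.\<close>
      have bound: "(\<integral>\<^sup>+x. (\<integral>\<^sup>+y. 4 * (h (c *\<^sub>R x + d *\<^sub>R y) * indicator B x * indicator B y) \<partial>lborel) \<partial>lborel)
          \<le> 4 * (ennreal (2 ^ CARD('n)) * I * emeasure lborel B)" if d: "1/2 \<le> d" for c d :: real
      proof -
        have "(\<integral>\<^sup>+x. (\<integral>\<^sup>+y. 4 * (h (c *\<^sub>R x + d *\<^sub>R y) * indicator B x * indicator B y) \<partial>lborel) \<partial>lborel)
          \<le> (\<integral>\<^sup>+x. (4 * (ennreal (2 ^ CARD('n)) * I)) * indicator B x \<partial>lborel)"
        proof (rule nn_integral_mono)
          fix x
          show "(\<integral>\<^sup>+y. 4 * (h (c *\<^sub>R x + d *\<^sub>R y) * indicator B x * indicator B y) \<partial>lborel)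
            \<le> (4 * (ennreal (2 ^ CARD('n)) * I)) * indicator B x"
          proof (cases "x \<in> B")
            case True
            have "(\<integral>\<^sup>+y. 4 * (h (c *\<^sub>R x + d *\<^sub>R y) * indicator B x * indicator B y) \<partial>lborel)
              \<le> (\<integral>\<^sup>+y. 4 * h (c *\<^sub>R x + d *\<^sub>R y) \<partial>lborel)"
              by (intro nn_integral_mono) (auto simp: indicator_def)
            also have "\<dots> \<le> 4 * (ennreal (2 ^ CARD('n)) * I)"
              using scale[OF d, of "c *\<^sub>R x"] by (simp add: nn_integral_cmult mult_left_mono)
            finally show ?thesis using True by simp
          qed simp
        qed
        also have "\<dots> = 4 * (ennreal (2 ^ CARD('n)) * I * emeasure lborel B)"
          by (subst nn_integral_cmult_indicator) (auto simp: mult.assoc)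
        finally show ?thesis .
      qed
      \<comment> \<open>Integrating first in the endpoint whose weight is at least 1/2 keeps the Jacobian below 2^n.\<close>
      show ?thesis
      proof (cases "1/2 \<le> t")
        case True
        have "(\<integral>\<^sup>+x. (\<integral>\<^sup>+y. F t x y \<partial>lborel) \<partial>lborel) = (\<integral>\<^sup>+y. (\<integral>\<^sup>+x. F t x y \<partial>lborel) \<partial>lborel)"
          by (intro lborel_pair.Fubini') (unfold F_def, measurable)
        also have "\<dots> = (\<integral>\<^sup>+y. (\<integral>\<^sup>+x. 4 * (h ((1 - t) *\<^sub>R y + t *\<^sub>R x) * indicator B y * indicator B x) \<partial>lborel) \<partial>lborel)"
          using t by (simp add: F_def algebra_simps)
        finally show ?thesis using bound[OF True] t by simp
      next
        case False
        have "(\<integral>\<^sup>+x. (\<integral>\<^sup>+y. F t x y \<partial>lborel) \<partial>lborel) =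
          (\<integral>\<^sup>+x. (\<integral>\<^sup>+y. 4 * (h (t *\<^sub>R x + (1 - t) *\<^sub>R y) * indicator B x * indicator B y) \<partial>lborel) \<partial>lborel)"
          using t by (simp add: F_def algebra_simps)
        then show ?thesis using bound[of "1 - t" t] False t by simp
      qed
    qed (simp add: F_def)
  qed
  also have "\<dots> = ennreal (4 * 2 ^ CARD('n)) * emeasure lborel B * I"
    by (subst nn_integral_cmult_indicator) (auto simp: ennreal_mult' mult_ac)
  finally show ?thesis unfolding I_def h_def .
qed

subsection \<open>A trace inequality of Poincare type on the unit ball\<close>

lemma set_integrable_bounded:
  fixes f :: "'a::euclidean_space \<Rightarrow> real"
  assumes f: "f \<in> borel_measurable borel" and S: "S \<in> sets borel" "bounded S"
    and M: "\<And>x. x \<in> S \<Longrightarrow> \<bar>f x\<bar> \<le> M"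
  shows "set_integrable lborel S f"
  unfolding set_integrable_def
proof (rule Bochner_Integration.integrable_bound)
  show "integrable lborel (\<lambda>x. indicator S x *\<^sub>R M)"
    using S emeasure_bounded_finite[of S] by (intro integrable_scaleR_left) simp
  show "(\<lambda>x. indicator S x *\<^sub>R f x) \<in> borel_measurable lborel"
    using f S by measurable
  show "AE x in lborel. norm (indicator S x *\<^sub>R f x) \<le> norm (indicator S x *\<^sub>R M)"
    using M by (auto simp: indicator_def intro!: AE_I2 order_trans[OF M abs_ge_self])
qed

text \<open>Negative \<open>c\<close> is included for the sake of the reflection
  \<open>c = -1\<close>, by which odd functions are seen to integrate to 0.\<close>

lemma integral_lborel_affine:
  fixes f :: "'a::euclidean_space \<Rightarrow> real"
  assumes [measurable]: "f \<in> borel_measurable borel" and c: "c \<noteq> 0"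
  shows "(\<integral>x. f x \<partial>lborel) = \<bar>c\<bar> ^ DIM('a) * (\<integral>x. f (z + c *\<^sub>R x) \<partial>lborel)"
proof -
  have "(\<integral>x. f x \<partial>lborel) = (\<integral>x. f x \<partial>density (distr lborel borel (\<lambda>x. z + c *\<^sub>R x)) (\<lambda>_. ennreal (\<bar>c\<bar> ^ DIM('a))))"
    using lborel_affine[of c z] c by simp
  also have "\<dots> = (\<integral>x. \<bar>c\<bar> ^ DIM('a) * f (z + c *\<^sub>R x) \<partial>lborel)"
    by (simp add: integral_density integral_distr)
  finally show ?thesis by simp
qed

text \<open>The integrand is constant along rays, so dilation by 1/2 shows that the half ball
  carries the share \<open>1 / 2 ^ DIM('a)\<close> of the integral. This moves the mean and the
  square norm from the whole ball, over which sphere integrals are defined, to the annulus, on which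
  the radial estimate holds.\<close>

lemma set_integral_half_ball_homogeneous:
  fixes f :: "'a::euclidean_space \<Rightarrow> real"
  assumes f: "f \<in> borel_measurable borel" and bd: "\<And>x. \<bar>f x\<bar> \<le> M"
  shows "(LINT x:ball 0 1 - ball 0 (1/2)|lborel. f (x /\<^sub>R norm x)) =
    (1 - 1 / 2 ^ DIM('a)) * (LINT x:ball 0 1|lborel. f (x /\<^sub>R norm x))"
proof -
  note f[measurable]
  have int: "set_integrable lborel S (\<lambda>x. f (x /\<^sub>R norm x))" if "S \<in> sets borel" "bounded S" for S
    using that bd by (intro set_integrable_bounded) auto
  have "(LINT x:ball 0 (1/2)|lborel. f (x /\<^sub>R norm x)) =
      (1/2) ^ DIM('a) * (LINT x:ball 0 1|lborel. f (x /\<^sub>R norm x))"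
  proof -
    have "(LINT x:ball 0 (1/2)|lborel. f (x /\<^sub>R norm x)) =
      \<bar>1/2\<bar> ^ DIM('a) * (\<integral>x. indicator (ball 0 (1/2)) (0 + (1/2) *\<^sub>R x) *\<^sub>R f ((0 + (1/2) *\<^sub>R x) /\<^sub>R norm (0 + (1/2) *\<^sub>R x)) \<partial>lborel)"
      unfolding set_lebesgue_integral_def
    proof (rule integral_lborel_affine)
      show "(\<lambda>x::'a. indicator (ball 0 (1/2)) x *\<^sub>R f (x /\<^sub>R norm x)) \<in> borel_measurable borel"
        by (intro borel_measurable_scaleR borel_measurable_indicator measurable_compose[OF _ f]) auto
    qed simp
    also have "(\<lambda>x::'a. indicator (ball 0 (1/2)) (0 + (1/2) *\<^sub>R x) *\<^sub>R f ((0 + (1/2) *\<^sub>R x) /\<^sub>R norm (0 + (1/2) *\<^sub>R x)))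
       = (\<lambda>x. indicator (ball 0 1) x *\<^sub>R f (x /\<^sub>R norm x))"
      by (auto simp: indicator_def fun_eq_iff inverse_eq_divide)
    finally show ?thesis by (simp add: set_lebesgue_integral_def)
  qed
  moreover have "(LINT x:ball 0 1|lborel. f (x /\<^sub>R norm x)) =
      (LINT x:ball 0 (1/2)|lborel. f (x /\<^sub>R norm x)) + (LINT x:ball 0 1 - ball 0 (1/2)|lborel. f (x /\<^sub>R norm x))"
  proof -
    have "ball 0 1 = ball 0 (1/2) \<union> (ball (0::'a) 1 - ball 0 (1/2))" by auto
    moreover have "(LINT x:ball 0 (1/2) \<union> (ball (0::'a) 1 - ball 0 (1/2))|lborel. f (x /\<^sub>R norm x)) =
      (LINT x:ball 0 (1/2)|lborel. f (x /\<^sub>R norm x)) + (LINT x:ball 0 1 - ball 0 (1/2)|lborel. f (x /\<^sub>R norm x))"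
      by (rule set_integral_Un) (auto intro!: int bounded_diff)
    ultimately show ?thesis by (simp only:)
  qed
  ultimately show ?thesis by (simp add: algebra_simps power_one_over)
qed

lemma nn_set_integral_eq:
  fixes f :: "'a \<Rightarrow> real"
  assumes "set_integrable M S f" "\<And>x. x \<in> S \<Longrightarrow> 0 \<le> f x"
  shows "(\<integral>\<^sup>+x. ennreal (f x) * indicator S x \<partial>M) = ennreal (LINT x:S|M. f x)"
proof -
  have "(\<integral>\<^sup>+x. ennreal (f x) * indicator S x \<partial>M) = (\<integral>\<^sup>+x. ennreal (indicator S x *\<^sub>R f x) \<partial>M)"
    by (intro nn_integral_cong) (simp add: indicator_def)
  also have "\<dots> = ennreal (LINT x:S|M. f x)"
    unfolding set_lebesgue_integral_def
    by (rule nn_integral_eq_integral)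
      (use assms in \<open>auto simp: set_integrable_def indicator_def\<close>)
  finally show ?thesis .
qed

text \<open>The integral of \<open>(g x - v y)\<^sup>2\<close> over annulus times ball is bounded
  from both sides. Below: at least \<open>\<beta> * (J / 2)\<close>. Above: at most
  \<open>2 * \<beta> * I\<close> from the radial increments plus
  \<open>2 * 4 * 2 ^ CARD('n) * \<beta> * I\<close> from the chords. Cancelling
  \<open>\<beta>\<close> and doubling gives \<open>4 + 16 * 2 ^ CARD('n)\<close>.\<close>

lemma trace_poincare_unit_ball_bounded:
  fixes v :: "real^'n \<Rightarrow> real"
  assumes C1: "C1_cball_grad 1 v G" and v: "v \<in> borel_measurable borel"
    and M: "\<And>x. \<bar>v x\<bar> \<le> M"
    and mean: "(LINT x:ball 0 1|lborel. v (x /\<^sub>R norm x)) = 0"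
  shows "ennreal (LINT x:ball 0 1|lborel. (v (x /\<^sub>R norm x))\<^sup>2) \<le>
    ennreal (4 + 16 * 2 ^ CARD('n)) * (\<integral>\<^sup>+x. grad_density 1 G x \<partial>lborel)"
proof -
  define g where "g x = v (x /\<^sub>R norm x)" for x
  define B A :: "(real^'n) set" where "B = ball 0 1" and "A = ball 0 1 - ball 0 (1/2)"
  define I where "I = (\<integral>\<^sup>+x. grad_density 1 G x \<partial>lborel)"
  note v[measurable]
  have g[measurable]: "g \<in> borel_measurable borel" unfolding g_def by measurable
  have AB[measurable]: "A \<in> sets borel" "B \<in> sets borel" by (auto simp: A_def B_def)
  have bAB: "bounded A" "bounded B" by (auto simp: A_def B_def bounded_diff)
  have gM: "\<bar>g x\<bar> \<le> M" for x using M by (simp add: g_def)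
  have sq: "a\<^sup>2 \<le> M\<^sup>2" if "\<bar>a\<bar> \<le> M" for a :: real
    using that by (metis abs_ge_zero power2_abs power_mono)
  note int = set_integrable_bounded[OF _ AB(1) bAB(1)] set_integrable_bounded[OF _ AB(2) bAB(2)]
  have ints: "set_integrable lborel A g" "set_integrable lborel A (\<lambda>x. (g x)\<^sup>2)"
    "set_integrable lborel B v" "set_integrable lborel B (\<lambda>x. (v x)\<^sup>2)"
    using gM M sq by (intro int(1)[where M=M] int(2)[where M=M] int(1)[where M="M\<^sup>2"] int(2)[where M="M\<^sup>2"]; auto)+
  have const: "set_integrable lborel A (\<lambda>x. c)" "set_integrable lborel B (\<lambda>x. c)" for c :: real
    by (auto intro!: int)
  define \<beta> where "\<beta> = measure lborel B"
  have \<beta>: "0 < \<beta>" "emeasure lborel B = ennreal \<beta>"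
  proof -
    show "0 < \<beta>" unfolding \<beta>_def B_def using content_ball_pos[of 1 "0::real^'n"] by simp
    show "emeasure lborel B = ennreal \<beta>"
      unfolding \<beta>_def using emeasure_bounded_finite[OF bAB(2)] by (simp add: emeasure_eq_ennreal_measure)
  qed
  have LINT_const: "(LINT x:S|lborel. c) = measure lborel S * c" for S :: "(real^'n) set" and c :: real
    by (simp add: set_lebesgue_integral_def)
  define V where "V = (LINT y:B|lborel. v y)"
  define W where "W = (LINT y:B|lborel. (v y)\<^sup>2)"
  have W0: "0 \<le> W" unfolding W_def set_lebesgue_integral_def by (rule integral_nonneg_AE) auto
  define J where "J = (LINT x:B|lborel. (g x)\<^sup>2)"
  have J0: "0 \<le> J" unfolding J_def set_lebesgue_integral_def by (rule integral_nonneg_AE) auto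
  \<comment> \<open>As a polynomial in \<open>c\<close> this can be integrated again at
    \<open>c = g x\<close>, where only the integrals of \<open>g\<close> and of its square
    enter.\<close>
  have inner: "(LINT y:B|lborel. (c - v y)\<^sup>2) = \<beta> * c\<^sup>2 - 2 * V * c + W" for c
  proof -
    have "(LINT y:B|lborel. (c - v y)\<^sup>2) = (LINT y:B|lborel. c\<^sup>2 - (2 * c) * v y + (v y)\<^sup>2)"
      by (simp add: power2_eq_square algebra_simps)
    also have "\<dots> = \<beta> * c\<^sup>2 - 2 * c * V + W"
      using ints const \<beta> by (simp add: V_def W_def \<beta>_def set_integral_add set_integral_diff LINT_const)
    finally show ?thesis by simp
  qed
  have meanA: "(LINT x:A|lborel. g x) = 0"
    using set_integral_half_ball_homogeneous[OF v M] mean by (simp add: g_def A_def)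
  have sqA: "(LINT x:A|lborel. (g x)\<^sup>2) = (1 - 1 / 2 ^ CARD('n)) * J"
    using set_integral_half_ball_homogeneous[of "\<lambda>x. (v x)\<^sup>2" "M\<^sup>2"] M sq by (simp add: g_def A_def J_def B_def)
  have outer: "(LINT x:A|lborel. \<beta> * (g x)\<^sup>2 - 2 * V * g x + W) = \<beta> * ((1 - 1 / 2 ^ CARD('n)) * J) + measure lborel A * W"
    using ints const meanA sqA by (simp add: set_integral_add set_integral_diff LINT_const)
  have N: "(\<integral>\<^sup>+x. (\<integral>\<^sup>+y. ennreal ((g x - v y)\<^sup>2) * indicator B y \<partial>lborel) * indicator A x \<partial>lborel)
     = ennreal (\<beta> * ((1 - 1 / 2 ^ CARD('n)) * J) + measure lborel A * W)"
  proof -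
    have i: "set_integrable lborel B (\<lambda>y. (c - v y)\<^sup>2)" for c
    proof -
      have "set_integrable lborel B (\<lambda>y. c\<^sup>2 - (2 * c) * v y + (v y)\<^sup>2)"
        using ints const by (intro set_integral_add set_integral_diff set_integrable_mult_right) auto
      then show ?thesis by (simp add: power2_eq_square algebra_simps)
    qed
    have "(\<integral>\<^sup>+x. (\<integral>\<^sup>+y. ennreal ((g x - v y)\<^sup>2) * indicator B y \<partial>lborel) * indicator A x \<partial>lborel)
      = (\<integral>\<^sup>+x. ennreal (\<beta> * (g x)\<^sup>2 - 2 * V * g x + W) * indicator A x \<partial>lborel)"
      by (simp add: nn_set_integral_eq[OF i] inner)
    also have "\<dots> = ennreal (LINT x:A|lborel. \<beta> * (g x)\<^sup>2 - 2 * V * g x + W)"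
    proof (rule nn_set_integral_eq)
      show "set_integrable lborel A (\<lambda>x. \<beta> * (g x)\<^sup>2 - 2 * V * g x + W)"
        using ints const by (intro set_integral_add set_integral_diff set_integrable_mult_right) auto
      show "0 \<le> \<beta> * (g x)\<^sup>2 - 2 * V * g x + W" for x
        unfolding inner[symmetric] set_lebesgue_integral_def by (rule integral_nonneg_AE) auto
    qed
    finally show ?thesis by (simp add: outer)
  qed
  \<comment> \<open>The cross term of N vanishes because g has mean zero, so no constant need be subtracted from v.\<close>
  have "ennreal \<beta> * ennreal (J / 2) \<le> ennreal (\<beta> * ((1 - 1 / 2 ^ CARD('n)) * J) + measure lborel A * W)"
  proof -
    \<comment> \<open>The annulus keeps at least half of \<open>J\<close>, because
      \<open>1 / 2 ^ CARD('n)\<close> is at most 1/2. The term with \<open>W\<close> is nonnegative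
      and is dropped.\<close>
    have "(2::real) ^ 1 \<le> 2 ^ CARD('n)" by (intro power_increasing) (auto simp: Suc_le_eq)
    then have "1 / 2 \<le> 1 - 1 / (2::real) ^ CARD('n)" by (simp add: field_simps)
    then have "1 / 2 * J \<le> (1 - 1 / 2 ^ CARD('n)) * J" using J0 by (intro mult_right_mono) auto
    then have "\<beta> * (J / 2) \<le> \<beta> * ((1 - 1 / 2 ^ CARD('n)) * J)" using \<beta> by (intro mult_left_mono) auto
    moreover have "0 \<le> measure lborel A * W" using W0 by simp
    ultimately have "\<beta> * (J / 2) \<le> \<beta> * ((1 - 1 / 2 ^ CARD('n)) * J) + measure lborel A * W" by linarith
    then show ?thesis using \<beta>(1) by (subst ennreal_mult'[symmetric]) (auto intro!: ennreal_leI simp del: ennreal_plus)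
  qed
  also have "\<dots> = (\<integral>\<^sup>+x. (\<integral>\<^sup>+y. ennreal ((g x - v y)\<^sup>2) * indicator B y \<partial>lborel) * indicator A x \<partial>lborel)"
    by (simp add: N)
  also have "\<dots> \<le> (\<integral>\<^sup>+x. (\<integral>\<^sup>+y. 2 * ennreal ((g x - v x)\<^sup>2) * indicator B y + 2 * (ennreal ((v x - v y)\<^sup>2) * indicator B y) \<partial>lborel) * indicator A x \<partial>lborel)"
  proof (intro nn_integral_mono mult_right_mono)
    fix x y
    have "(g x - v y)\<^sup>2 \<le> 2 * (g x - v x)\<^sup>2 + 2 * (v x - v y)\<^sup>2"
      using zero_le_power2[of "(g x - v x) - (v x - v y)"] by (simp add: power2_eq_square algebra_simps)
    then have "ennreal ((g x - v y)\<^sup>2) \<le> 2 * ennreal ((g x - v x)\<^sup>2) + 2 * ennreal ((v x - v y)\<^sup>2)"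
      using ennreal_leI[of "(g x - v y)\<^sup>2" "2 * (g x - v x)\<^sup>2 + 2 * (v x - v y)\<^sup>2"]
      by (simp add: ennreal_mult')
    then show "ennreal ((g x - v y)\<^sup>2) * indicator B y \<le> 2 * ennreal ((g x - v x)\<^sup>2) * indicator B y + 2 * (ennreal ((v x - v y)\<^sup>2) * indicator B y)"
      by (simp add: indicator_def)
  qed simp
  also have "\<dots> = 2 * ennreal \<beta> * (\<integral>\<^sup>+x. ennreal ((g x - v x)\<^sup>2) * indicator A x \<partial>lborel)
      + 2 * (\<integral>\<^sup>+x. (\<integral>\<^sup>+y. ennreal ((v x - v y)\<^sup>2) * indicator B y \<partial>lborel) * indicator A x \<partial>lborel)"
  proof -
    define a where "a x = ennreal ((g x - v x)\<^sup>2)" for x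
    define q where "q x = (\<integral>\<^sup>+y. ennreal ((v x - v y)\<^sup>2) * indicator B y \<partial>lborel)" for x
    have [measurable]: "a \<in> borel_measurable borel" "q \<in> borel_measurable borel"
      unfolding a_def q_def by measurable
    have "(\<integral>\<^sup>+y. 2 * a x * indicator B y + 2 * (ennreal ((v x - v y)\<^sup>2) * indicator B y) \<partial>lborel)
        = 2 * a x * ennreal \<beta> + 2 * q x" for x
    proof -
      have "(\<integral>\<^sup>+y. 2 * a x * indicator B y + 2 * (ennreal ((v x - v y)\<^sup>2) * indicator B y) \<partial>lborel)
        = (\<integral>\<^sup>+y. 2 * a x * indicator B y \<partial>lborel) + (\<integral>\<^sup>+y. 2 * (ennreal ((v x - v y)\<^sup>2) * indicator B y) \<partial>lborel)"
        by (rule nn_integral_add) measurable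
      also have "(\<integral>\<^sup>+y. 2 * a x * indicator B y \<partial>lborel) = 2 * a x * ennreal \<beta>"
        unfolding \<beta>(2)[symmetric] by (rule nn_integral_cmult_indicator) simp
      also have "(\<integral>\<^sup>+y. 2 * (ennreal ((v x - v y)\<^sup>2) * indicator B y) \<partial>lborel) = 2 * q x"
        unfolding q_def by (rule nn_integral_cmult) measurable
      finally show ?thesis .
    qed
    then have "(\<integral>\<^sup>+x. (\<integral>\<^sup>+y. 2 * a x * indicator B y + 2 * (ennreal ((v x - v y)\<^sup>2) * indicator B y) \<partial>lborel) * indicator A x \<partial>lborel)
      = (\<integral>\<^sup>+x. (2 * a x * ennreal \<beta> + 2 * q x) * indicator A x \<partial>lborel)"
      by presburger
    also have "\<dots> = (\<integral>\<^sup>+x. 2 * ennreal \<beta> * (a x * indicator A x) + 2 * (q x * indicator A x) \<partial>lborel)"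
      by (intro nn_integral_cong) (simp add: indicator_def mult_ac)
    also have "\<dots> = (\<integral>\<^sup>+x. 2 * ennreal \<beta> * (a x * indicator A x) \<partial>lborel) + (\<integral>\<^sup>+x. 2 * (q x * indicator A x) \<partial>lborel)"
      by (rule nn_integral_add) measurable
    also have "(\<integral>\<^sup>+x. 2 * ennreal \<beta> * (a x * indicator A x) \<partial>lborel) = 2 * ennreal \<beta> * (\<integral>\<^sup>+x. a x * indicator A x \<partial>lborel)"
      by (rule nn_integral_cmult) measurable
    also have "(\<integral>\<^sup>+x. 2 * (q x * indicator A x) \<partial>lborel) = 2 * (\<integral>\<^sup>+x. q x * indicator A x \<partial>lborel)"
      by (rule nn_integral_cmult) measurable
    finally show ?thesis by (simp only: a_def q_def)
  qed
  also have "\<dots> \<le> 2 * ennreal \<beta> * I + 2 * (ennreal (4 * 2 ^ CARD('n)) * ennreal \<beta> * I)"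
  proof (intro add_mono mult_left_mono)
    show "(\<integral>\<^sup>+x. ennreal ((g x - v x)\<^sup>2) * indicator A x \<partial>lborel) \<le> I"
      using nn_integral_radial_increment_le[OF C1] by (simp add: g_def A_def I_def)
    have "(\<integral>\<^sup>+x. (\<integral>\<^sup>+y. ennreal ((v x - v y)\<^sup>2) * indicator B y \<partial>lborel) * indicator A x \<partial>lborel)
      \<le> (\<integral>\<^sup>+x. (\<integral>\<^sup>+y. ennreal ((v x - v y)\<^sup>2) * indicator B y \<partial>lborel) * indicator B x \<partial>lborel)"
      by (intro nn_integral_mono) (auto simp: A_def B_def indicator_def)
    also have "\<dots> \<le> ennreal (4 * 2 ^ CARD('n)) * ennreal \<beta> * I"
      using nn_integral_pair_increment_le[OF C1] by (simp add: \<beta>(2)[symmetric] B_def I_def)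
    finally show "(\<integral>\<^sup>+x. (\<integral>\<^sup>+y. ennreal ((v x - v y)\<^sup>2) * indicator B y \<partial>lborel) * indicator A x \<partial>lborel)
      \<le> ennreal (4 * 2 ^ CARD('n)) * ennreal \<beta> * I" .
  qed simp_all
  also have "\<dots> = ennreal \<beta> * (ennreal (2 + 8 * 2 ^ CARD('n)) * I)"
  proof -
    have "2 + 2 * ennreal (4 * q) = ennreal (2 + 8 * q)" if "0 \<le> q" for q
      using that ennreal_plus[of 2 "8 * q"] ennreal_mult'[of 2 "4 * q"] by simp
    then have "ennreal (2 + 8 * 2 ^ CARD('n)) = 2 + 2 * ennreal (4 * 2 ^ CARD('n))"
      by (metis zero_le_numeral zero_le_power)
    moreover have "2 * b * i + 2 * (k * b * i) = b * ((2 + 2 * k) * i)" for b i k :: ennreal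
      by (simp add: distrib_left distrib_right mult_ac)
    ultimately show ?thesis by presburger
  qed
  \<comment> \<open>\<open>\<beta>\<close> is positive and finite, so it cancels in
    \<open>ennreal\<close>.\<close>
  finally have "ennreal (J / 2) \<le> ennreal (2 + 8 * 2 ^ CARD('n)) * I"
    using \<beta> by (subst (asm) ennreal_mult_le_mult_iff) auto
  then have "2 * ennreal (J / 2) \<le> 2 * (ennreal (2 + 8 * 2 ^ CARD('n)) * I)"
    by (rule mult_left_mono) simp
  moreover have "2 * ennreal (J / 2) = ennreal J"
    using ennreal_mult'[of 2 "J / 2"] by simp
  moreover have "2 * (ennreal (2 + 8 * 2 ^ CARD('n)) * I) = ennreal (4 + 16 * 2 ^ CARD('n)) * I"
  proof -
    have "ennreal (4 + 16 * q) = 2 * ennreal (2 + 8 * q)" for q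
      using ennreal_mult'[of 2 "2 + 8 * q"] by (simp del: ennreal_plus)
    then show ?thesis by (simp only: mult.assoc)
  qed
  ultimately show ?thesis unfolding J_def g_def B_def I_def by (simp only:)
qed

section \<open>The trace inequality on a ball of radius R\<close>

lemma C1_cball_grad_continuous_on:
  assumes "C1_cball_grad R u G"
  shows "continuous_on (cball 0 R) u" "continuous_on (cball 0 R) G"
  using assms unfolding C1_cball_grad_def
  by (auto intro: has_derivative_continuous_on)

lemma continuous_on_cball_bounded:
  fixes u :: "'a::euclidean_space \<Rightarrow> 'b::real_normed_vector"
  assumes "continuous_on (cball 0 R) u"
  obtains M where "0 \<le> M" "\<And>x. x \<in> cball 0 R \<Longrightarrow> norm (u x) \<le> M"
proof -
  have "bounded (u ` cball 0 R)"
    using assms compact_cball compact_continuous_image compact_imp_bounded by blast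
  then obtain M where "0 < M" "\<forall>y\<in>u ` cball 0 R. norm y \<le> M"
    using bounded_pos by blast
  then show ?thesis using that[of M] by auto
qed

text \<open>\<open>v\<close> is tied to the dilate of \<open>u\<close> on the closed unit ball only,
  which allows a version cut off to zero outside.\<close>

lemma C1_cball_grad_rescale:
  fixes u v :: "real^'n \<Rightarrow> real"
  assumes C1: "C1_cball_grad R u G" and R: "R > 0"
    and v: "\<And>x. x \<in> cball 0 1 \<Longrightarrow> v x = u (R *\<^sub>R x)"
  shows "C1_cball_grad 1 v (\<lambda>x. R *\<^sub>R G (R *\<^sub>R x))"
  unfolding C1_cball_grad_def
proof (intro conjI ballI)
  have sub: "(\<lambda>x. R *\<^sub>R x) ` cball 0 1 \<subseteq> cball (0::real^'n) R" using R by auto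
  fix x assume x: "x \<in> cball (0::real^'n) 1"
  have "((\<lambda>x. R *\<^sub>R x) has_derivative (\<lambda>h. R *\<^sub>R h)) (at x within cball 0 1)"
    by (auto intro!: derivative_eq_intros)
  moreover have "(u has_derivative (\<lambda>h. G (R *\<^sub>R x) \<bullet> h)) (at (R *\<^sub>R x) within (\<lambda>x. R *\<^sub>R x) ` cball 0 1)"
    using C1 sub x has_derivative_subset unfolding C1_cball_grad_def by blast
  ultimately have "((\<lambda>x. u (R *\<^sub>R x)) has_derivative (\<lambda>h. G (R *\<^sub>R x) \<bullet> (R *\<^sub>R h))) (at x within cball 0 1)"
    by (rule has_derivative_in_compose)
  then have "(v has_derivative (\<lambda>h. G (R *\<^sub>R x) \<bullet> (R *\<^sub>R h))) (at x within cball 0 1)"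
    by (rule has_derivative_transform[OF x, rotated]) (rule v)
  then show "(v has_derivative (\<lambda>h. (R *\<^sub>R G (R *\<^sub>R x)) \<bullet> h)) (at x within cball 0 1)"
    by simp
next
  show "continuous_on (cball 0 1) (\<lambda>x. R *\<^sub>R G (R *\<^sub>R x))"
    by (intro continuous_intros continuous_on_compose2[OF C1_cball_grad_continuous_on(2)[OF C1]])
      (use R in auto)
qed

text \<open>The density lives on the closed ball and the Dirichlet integral on the open one; the
  bounding sphere is negligible. Continuity of \<open>G\<close> up to the boundary makes the
  integral finite.\<close>

lemma nn_integral_grad_density:
  fixes u :: "real^'n \<Rightarrow> real"
  assumes C1: "C1_cball_grad R u G"
  shows "(\<integral>\<^sup>+x. grad_density R G x \<partial>lborel) = ennreal (integral (ball 0 R) (\<lambda>x. (norm (G x))\<^sup>2))"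
proof -
  have "continuous_on (cball 0 R) (\<lambda>x. (norm (G x))\<^sup>2)"
    using C1_cball_grad_continuous_on(2)[OF C1] by (intro continuous_intros)
  then have int: "set_integrable lborel (cball 0 R) (\<lambda>x. (norm (G x))\<^sup>2)"
    unfolding set_integrable_def by (intro borel_integrable_compact compact_cball)
  have "integral (cball 0 R) (\<lambda>x. (norm (G x))\<^sup>2) = integral (ball 0 R) (\<lambda>x. (norm (G x))\<^sup>2)"
  proof (rule integral_spike_set)
    show "negligible {x \<in> cball 0 R - ball 0 R. (norm (G x))\<^sup>2 \<noteq> 0}"
      by (rule negligible_subset[OF negligible_sphere[of 0 R]]) auto
    show "negligible {x \<in> ball 0 R - cball 0 R. (norm (G x))\<^sup>2 \<noteq> 0}"
      by (rule negligible_subset[OF negligible_sphere[of 0 R]]) auto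
  qed
  then show ?thesis
    unfolding grad_density_def
    using nn_set_integral_eq[OF int] set_borel_integral_eq_integral(2)[OF int] by simp
qed

text \<open>The non-integrable case is covered as well: there \<open>integral\<close> takes its
  default value 0.\<close>

lemma integral_nonneg':
  fixes f :: "'a::euclidean_space \<Rightarrow> real"
  assumes "\<And>x. x \<in> S \<Longrightarrow> 0 \<le> f x"
  shows "0 \<le> integral S f"
  by (cases "f integrable_on S") (auto simp: not_integrable_integral intro: integral_nonneg assms)

lemma trace_poincare:
  fixes R :: real
  assumes R: "R > 0"
  obtains K where "K > 0"
    "\<And>(u :: real^'n \<Rightarrow> real) G. C1_cball_grad R u G \<Longrightarrow> unit_sphere_integral (\<lambda>w. u (R *\<^sub>R w)) = 0 \<Longrightarrow>
      unit_sphere_integral (\<lambda>w. (u (R *\<^sub>R w))\<^sup>2) \<le> K * integral (ball 0 R) (\<lambda>x. (norm (G x))\<^sup>2)"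
proof -
  define C where "C = (4 + 16 * 2 ^ CARD('n) :: real)"
  \<comment> \<open>\<open>CARD('n)\<close> is the normalisation of
    \<open>unit_sphere_integral\<close>, \<open>R\<^sup>2\<close> comes from the gradient of the
    dilated function, and \<open>1 / R ^ CARD('n)\<close> from the change of volume.\<close>
  define K where "K = real CARD('n) * (C * (R\<^sup>2 * (1 / R ^ CARD('n))))"
  have C: "C > 0" unfolding C_def by (intro add_pos_pos) auto
  have K: "K > 0" using R C by (simp add: K_def)
  have "unit_sphere_integral (\<lambda>w. (u (R *\<^sub>R w))\<^sup>2) \<le> K * integral (ball 0 R) (\<lambda>x. (norm (G x))\<^sup>2)"
    if C1: "C1_cball_grad R u G" and mean: "unit_sphere_integral (\<lambda>w. u (R *\<^sub>R w)) = 0"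
    for u :: "real^'n \<Rightarrow> real" and G
  proof -
    \<comment> \<open>The cut-off makes \<open>v\<close> Borel and bounded on the whole space.
      Radial projection lands in the closed ball, also at 0, where division by zero gives 0; so the
      traces are unaffected.\<close>
    define v where "v x = indicator (cball 0 1) x *\<^sub>R u (R *\<^sub>R x)" for x
    have cont: "continuous_on (cball 0 1) (\<lambda>x. u (R *\<^sub>R x))"
      by (intro continuous_intros continuous_on_compose2[OF C1_cball_grad_continuous_on(1)[OF C1]])
        (use R in auto)
    have v[measurable]: "v \<in> borel_measurable borel"
      unfolding v_def by (intro borel_measurable_continuous_on_indicator cont) simp
    obtain M where "0 \<le> M" "\<And>x. x \<in> cball 0 1 \<Longrightarrow> norm (u (R *\<^sub>R x)) \<le> M"
      using continuous_on_cball_bounded[OF cont] by blast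
    then have M: "\<bar>v x\<bar> \<le> M" for x by (simp add: v_def indicator_def)
    have vu: "v (x /\<^sub>R norm x) = u (R *\<^sub>R (x /\<^sub>R norm x))" for x
    proof -
      have "x /\<^sub>R norm x \<in> cball 0 1" by (cases "x = 0") auto
      then show ?thesis by (simp add: v_def)
    qed
    have C1v: "C1_cball_grad 1 v (\<lambda>x. R *\<^sub>R G (R *\<^sub>R x))"
      by (rule C1_cball_grad_rescale[OF C1 R]) (simp add: v_def)
    have sq: "a\<^sup>2 \<le> M\<^sup>2" if "\<bar>a\<bar> \<le> M" for a :: real
      using that by (metis abs_ge_zero power2_abs power_mono)
    have int: "set_integrable lborel (ball 0 1) (\<lambda>x. v (x /\<^sub>R norm x))"
      "set_integrable lborel (ball 0 1) (\<lambda>x. (v (x /\<^sub>R norm x))\<^sup>2)"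
      using M sq by (intro set_integrable_bounded[where M=M] set_integrable_bounded[where M="M\<^sup>2"]; auto)+
    have usi: "unit_sphere_integral (\<lambda>w. u (R *\<^sub>R w)) = CARD('n) * (LINT x:ball 0 1|lborel. v (x /\<^sub>R norm x))"
      "unit_sphere_integral (\<lambda>w. (u (R *\<^sub>R w))\<^sup>2) = CARD('n) * (LINT x:ball 0 1|lborel. (v (x /\<^sub>R norm x))\<^sup>2)"
      using set_borel_integral_eq_integral(2)[OF int(1)] set_borel_integral_eq_integral(2)[OF int(2)]
      unfolding unit_sphere_integral_def vu by (simp_all only:)
    define E where "E = integral (ball 0 R) (\<lambda>x. (norm (G x))\<^sup>2)"
    have E0: "0 \<le> E" unfolding E_def by (rule integral_nonneg') simp
    have [measurable]: "grad_density R G \<in> borel_measurable borel"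
      using C1 by measurable
    have "grad_density 1 (\<lambda>x. R *\<^sub>R G (R *\<^sub>R x)) x = ennreal (R\<^sup>2) * grad_density R G (0 + R *\<^sub>R x)" for x
      using R by (simp add: grad_density_def power_mult_distrib ennreal_mult' mult.assoc indicator_def)
    then have "(\<integral>\<^sup>+x. grad_density 1 (\<lambda>x. R *\<^sub>R G (R *\<^sub>R x)) x \<partial>lborel)
        = ennreal (R\<^sup>2) * (\<integral>\<^sup>+x. grad_density R G (0 + R *\<^sub>R x) \<partial>lborel)"
      by (simp add: nn_integral_cmult)
    also have "\<dots> = ennreal (R\<^sup>2) * (ennreal (1 / R ^ CARD('n)) * ennreal E)"
      using nn_integral_lborel_affine[of "grad_density R G" R 0] R nn_integral_grad_density[OF C1]
      by (simp add: E_def)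
    also have "\<dots> = ennreal (R\<^sup>2 * (1 / R ^ CARD('n)) * E)"
    proof -
      have "ennreal (a * b * E) = ennreal a * (ennreal b * ennreal E)" if "0 \<le> a" "0 \<le> b" for a b
        using that E0 by (simp add: ennreal_mult mult.assoc)
      then show ?thesis by (rule sym) (use R in auto)
    qed
    finally have gd: "(\<integral>\<^sup>+x. grad_density 1 (\<lambda>x. R *\<^sub>R G (R *\<^sub>R x)) x \<partial>lborel) = ennreal (R\<^sup>2 * (1 / R ^ CARD('n)) * E)" .
    have "(LINT x:ball 0 1|lborel. v (x /\<^sub>R norm x)) = 0"
      using mean usi by simp
    from trace_poincare_unit_ball_bounded[OF C1v v M this]
    have "ennreal (LINT x:ball 0 1|lborel. (v (x /\<^sub>R norm x))\<^sup>2) \<le> ennreal C * ennreal (R\<^sup>2 * (1 / R ^ CARD('n)) * E)"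
      unfolding gd C_def .
    also have "\<dots> = ennreal (C * (R\<^sup>2 * (1 / R ^ CARD('n)) * E))"
      using C by (simp only: ennreal_mult' less_imp_le)
    finally have "(LINT x:ball 0 1|lborel. (v (x /\<^sub>R norm x))\<^sup>2) \<le> C * (R\<^sup>2 * (1 / R ^ CARD('n)) * E)"
      using C R E0 by (subst (asm) ennreal_le_iff) (auto intro!: mult_nonneg_nonneg)
    then have "CARD('n) * (LINT x:ball 0 1|lborel. (v (x /\<^sub>R norm x))\<^sup>2) \<le> CARD('n) * (C * (R\<^sup>2 * (1 / R ^ CARD('n)) * E))"
      by (intro mult_left_mono) auto
    then show ?thesis unfolding usi K_def E_def by (simp only: mult.assoc)
  qed
  with K that show ?thesis by blast
qed

section \<open>An admissible test function\<close>

lemma unit_sphere_integral_odd: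
  fixes f :: "real^'n \<Rightarrow> real"
  assumes f[measurable]: "f \<in> borel_measurable borel" and M: "\<And>x. norm x \<le> 1 \<Longrightarrow> \<bar>f x\<bar> \<le> M" and odd: "\<And>x. f (- x) = - f x"
  shows "unit_sphere_integral f = 0"
proof -
  have int: "set_integrable lborel (ball 0 1) (\<lambda>x. f (x /\<^sub>R norm x))"
  proof (rule set_integrable_bounded[where M=M])
    show "\<bar>f (x /\<^sub>R norm x)\<bar> \<le> M" for x
      by (rule M) (cases "x = 0"; simp)
  qed auto
  let ?h = "\<lambda>x::real^'n. indicator (ball 0 1) x *\<^sub>R f (x /\<^sub>R norm x)"
  have "(\<integral>x. ?h x \<partial>lborel) = \<bar>-1\<bar> ^ DIM(real^'n) * (\<integral>x. ?h (0 + (-1) *\<^sub>R x) \<partial>lborel)"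
  proof (rule integral_lborel_affine)
    show "?h \<in> borel_measurable borel"
      by (intro borel_measurable_scaleR borel_measurable_indicator measurable_compose[OF _ f]) auto
  qed simp
  also have "(\<lambda>x. ?h (0 + (-1) *\<^sub>R x)) = (\<lambda>x. - ?h x)"
    using odd by (auto simp: indicator_def fun_eq_iff)
  finally have "(\<integral>x. ?h x \<partial>lborel) = 0" by simp
  then show ?thesis
    unfolding unit_sphere_integral_def set_borel_integral_eq_integral(2)[OF int, symmetric]
    by (simp add: set_lebesgue_integral_def)
qed

text \<open>The rules for infima of reals require a nonempty set, so an admissible function has to
  be exhibited. Coordinates have mean zero on the sphere by oddness.\<close>

lemma exists_coordinate_test_function:
  assumes R: "R > 0"
  shows "\<exists>(u :: real^'n \<Rightarrow> real) G. C1_cball_grad R u G \<and> unit_sphere_integral (\<lambda>w. u (R *\<^sub>R w)) = 0 \<and>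
    unit_sphere_integral (\<lambda>w. (u (R *\<^sub>R w))\<^sup>2) \<noteq> 0"
proof -
  have C1: "C1_cball_grad R (\<lambda>x::real^'n. x $ i) (\<lambda>_. axis i 1)" for i
    unfolding C1_cball_grad_def
  proof (intro conjI ballI)
    fix x :: "real^'n"
    have "((\<lambda>x. axis i 1 \<bullet> x) has_derivative (\<lambda>h. axis i 1 \<bullet> h)) (at x within cball 0 R)"
      by (auto intro!: derivative_eq_intros)
    then show "((\<lambda>x. x $ i) has_derivative (\<lambda>h. axis i 1 \<bullet> h)) (at x within cball 0 R)"
      by (simp add: inner_axis')
  qed (rule continuous_on_const)
  have bd: "\<bar>(R *\<^sub>R x) $ i\<bar> \<le> R" if "norm x \<le> 1" for x :: "real^'n" and i
    using component_le_norm_cart[of x i] that R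
    by (simp add: abs_mult mult_left_le)
  have odd: "unit_sphere_integral (\<lambda>w::real^'n. (R *\<^sub>R w) $ i) = 0" for i
    by (rule unit_sphere_integral_odd[where M=R]) (use bd in auto)
  \<comment> \<open>The squares of the coordinates sum to R^2 on the sphere, so they cannot all integrate to 0.\<close>
  have "\<exists>i. unit_sphere_integral (\<lambda>w::real^'n. ((R *\<^sub>R w) $ i)\<^sup>2) \<noteq> 0"
  proof (rule ccontr)
    assume "\<not> ?thesis"
    then have 0: "integral (ball 0 1) (\<lambda>x::real^'n. ((R *\<^sub>R (x /\<^sub>R norm x)) $ i)\<^sup>2) = 0" for i
      unfolding unit_sphere_integral_def by (simp del: scaleR_scaleR vector_scaleR_component)
    have int: "(\<lambda>x::real^'n. ((R *\<^sub>R (x /\<^sub>R norm x)) $ i)\<^sup>2) integrable_on ball 0 1" for i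
    proof -
      have "((R *\<^sub>R (x /\<^sub>R norm x)) $ i)\<^sup>2 \<le> R\<^sup>2" for x :: "real^'n"
      proof -
        have "norm (x /\<^sub>R norm x) \<le> 1" by (cases "x = 0") auto
        from power_mono[OF bd[OF this, of i] abs_ge_zero, of 2] show ?thesis by (simp only: power2_abs)
      qed
      then have "set_integrable lborel (ball 0 1) (\<lambda>x::real^'n. ((R *\<^sub>R (x /\<^sub>R norm x)) $ i)\<^sup>2)"
        by (intro set_integrable_bounded[where M="R\<^sup>2"]) auto
      then show ?thesis by (rule set_borel_integral_eq_integral)
    qed
    have "integral (ball 0 1) (\<lambda>x::real^'n. \<Sum>i\<in>UNIV. ((R *\<^sub>R (x /\<^sub>R norm x)) $ i)\<^sup>2) = 0"
      using int by (subst integral_sum) (simp_all only: 0 sum.neutral_const finite_class.finite_UNIV)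
    moreover have "integral (ball 0 1) (\<lambda>x::real^'n. \<Sum>i\<in>UNIV. ((R *\<^sub>R (x /\<^sub>R norm x)) $ i)\<^sup>2)
        = integral (ball 0 1) (\<lambda>x::real^'n. R\<^sup>2)"
    \<comment> \<open>The origin is left out because \<open>x /\<^sub>R norm x\<close> is 0 there
      and not a unit vector.\<close>
    proof (rule integral_spike[of "{0}"])
      fix x :: "real^'n" assume "x \<in> ball 0 1 - {0}"
      then have "norm (x /\<^sub>R norm x) = 1" by simp
      then have "(norm (R *\<^sub>R (x /\<^sub>R norm x)))\<^sup>2 = R\<^sup>2"
        by (simp only: norm_scaleR mult_1_right power2_abs)
      then show "R\<^sup>2 = (\<Sum>i\<in>UNIV. ((R *\<^sub>R (x /\<^sub>R norm x)) $ i)\<^sup>2)"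
        by (simp only: norm_vec_def L2_set_def real_norm_def power2_abs real_sqrt_pow2 sum_nonneg zero_le_power2)
    qed simp
    moreover have "integral (ball 0 1) (\<lambda>x::real^'n. R\<^sup>2) = R\<^sup>2 * measure lborel (ball (0::real^'n) 1)"
    proof -
      have "set_integrable lborel (ball (0::real^'n) 1) (\<lambda>x. R\<^sup>2)"
        by (rule set_integrable_bounded[where M="R\<^sup>2"]) auto
      from set_borel_integral_eq_integral(2)[OF this] show ?thesis
        by (simp add: set_lebesgue_integral_def mult.commute)
    qed
    ultimately show False using R content_ball_pos[of 1 "0::real^'n"] by simp
  qed
  then show ?thesis using C1 odd by blast
qed

subsection \<open>Comparison of warping functions\<close>

lemma ratio_derivative_wronskian:
  fixes s t :: "real \<Rightarrow> real"
  assumes "(s has_real_derivative s') (at r within S)" "(t has_real_derivative t') (at r within S)" "t r \<noteq> 0"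
  shows "((\<lambda>r. s r / t r) has_real_derivative (s' * t r - s r * t') / (t r)\<^sup>2) (at r within S)"
  using assms by (auto intro!: derivative_eq_intros simp: power2_eq_square)

lemma has_real_derivative_nonpos_imp_le:
  fixes f :: "real \<Rightarrow> real"
  assumes "a \<le> b"
    and der: "\<And>x. x \<in> {a..b} \<Longrightarrow> (f has_real_derivative f' x) (at x within {a..b})"
    and neg: "\<And>x. x \<in> {a..b} \<Longrightarrow> f' x \<le> 0"
  shows "f b \<le> f a"
proof -
  have "\<exists>x\<in>{a..b}. f b - f a = f' x * (b - a)"
    using assms(1) by (rule mvt_very_simple) (use der in \<open>simp add: has_field_derivative_def\<close>)
  then obtain x where "x \<in> {a..b}" "f b - f a = f' x * (b - a)" by blast
  then show ?thesis using neg[of x] assms(1) by (smt (verit) mult_nonpos_nonneg)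
qed

text \<open>\<open>s1\<close> and \<open>s2\<close> stand for the first two derivatives, one-sided
  at the ends of the interval. This is the common ground of the given \<open>\<sigma>\<close> and of
  \<open>sin_k\<close>, so that either can take either role in the comparison.\<close>

definition warping_profile :: "(real \<Rightarrow> real) \<Rightarrow> (real \<Rightarrow> real) \<Rightarrow> (real \<Rightarrow> real) \<Rightarrow> real \<Rightarrow> bool" where
  "warping_profile s s1 s2 R \<longleftrightarrow> s 0 = 0 \<and> s1 0 = 1 \<and> (\<forall>r\<in>{0<..R}. s r > 0) \<and>
     (\<forall>r\<in>{0..R}. (s has_real_derivative s1 r) (at r within {0..R}) \<and>
        (s1 has_real_derivative s2 r) (at r within {0..R}))"

lemma warping_profile_tendsto_ratio:
  assumes s: "warping_profile s s1 s2 R" and R: "R > 0"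
  shows "((\<lambda>r. s r / r) \<longlongrightarrow> 1) (at 0 within {0..R})"
  using s R unfolding warping_profile_def has_field_derivative_iff by force

text \<open>Curvature is \<open>- s2 r / s r\<close>, so \<open>s\<close> is at least as curved as
  \<open>t\<close>. The Wronskian \<open>w\<close> has derivative
  \<open>s2 r * t r - s r * t2 r\<close>, nonpositive by the hypothesis, and vanishes at 0 because
  \<open>s\<close> and \<open>t\<close> do; hence \<open>w \<le> 0\<close>, and
  \<open>w / t\<^sup>2\<close> is the derivative of \<open>s / t\<close>. The bound 1 is the limit
  of the ratio at 0, where both slopes are 1.\<close>

lemma warping_ratio_antimono:
  fixes s t :: "real \<Rightarrow> real"
  assumes s: "warping_profile s s1 s2 R" and t: "warping_profile t t1 t2 R"
    and curv: "\<And>r. r \<in> {0<..R} \<Longrightarrow> s2 r / s r \<le> t2 r / t r"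
  shows "\<And>a b. 0 < a \<Longrightarrow> a \<le> b \<Longrightarrow> b \<le> R \<Longrightarrow> s b / t b \<le> s a / t a"
    and "\<And>a. 0 < a \<Longrightarrow> a \<le> R \<Longrightarrow> s a / t a \<le> 1"
proof -
  define w where "w r = s1 r * t r - s r * t1 r" for r
  have w': "(w has_real_derivative s2 r * t r - s r * t2 r) (at r within {0..R})" if "r \<in> {0..R}" for r
    unfolding w_def using s t that unfolding warping_profile_def
    by (auto intro!: derivative_eq_intros)
  have w: "w r \<le> 0" if r: "0 \<le> r" "r \<le> R" for r
  proof -
    have "w r \<le> w 0"
    proof (rule has_real_derivative_nonpos_imp_le[OF r(1)])
      fix x assume "x \<in> {0..r}"
      then have x: "x \<in> {0..R}" using r by auto
      show "(w has_real_derivative s2 x * t x - s x * t2 x) (at x within {0..r})"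
        by (rule DERIV_subset[OF w'[OF x]]) (use r in auto)
      show "s2 x * t x - s x * t2 x \<le> 0"
      \<comment> \<open>At 0 the curvature hypothesis says nothing, but there the expression is 0
        because \<open>s 0 = t 0 = 0\<close>.\<close>
      proof (cases "x = 0")
        case False
        then have "s x > 0" "t x > 0" using s t x by (auto simp: warping_profile_def)
        then show ?thesis using curv[of x] x False by (simp add: field_simps)
      qed (use s t in \<open>simp add: warping_profile_def\<close>)
    qed
    then show ?thesis using s t by (simp add: w_def warping_profile_def)
  qed
  show mono: "s b / t b \<le> s a / t a" if ab: "0 < a" "a \<le> b" "b \<le> R" for a b
  proof (rule has_real_derivative_nonpos_imp_le[OF ab(2)])
    fix x assume x: "x \<in> {a..b}"
    then have tx: "t x > 0" using ab t by (auto simp: warping_profile_def)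
    show "((\<lambda>r. s r / t r) has_real_derivative (s1 x * t x - s x * t1 x) / (t x)\<^sup>2) (at x within {a..b})"
    proof (rule ratio_derivative_wronskian)
      show "(s has_real_derivative s1 x) (at x within {a..b})"
        by (rule DERIV_subset[of _ _ _ "{0..R}"]) (use x ab s in \<open>auto simp: warping_profile_def\<close>)
      show "(t has_real_derivative t1 x) (at x within {a..b})"
        by (rule DERIV_subset[of _ _ _ "{0..R}"]) (use x ab t in \<open>auto simp: warping_profile_def\<close>)
    qed (use tx in simp)
    show "(s1 x * t x - s x * t1 x) / (t x)\<^sup>2 \<le> 0"
      using w[of x] x ab by (auto simp: w_def divide_nonpos_nonneg)
  qed
  show "s a / t a \<le> 1" if a: "0 < a" "a \<le> R" for a
  proof -
    have R: "R > 0" using a by simp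
    \<comment> \<open>Dividing both profiles by \<open>r\<close> resolves the form 0/0: each
      quotient tends to its slope 1.\<close>
    have "((\<lambda>r. (s r / r) / (t r / r)) \<longlongrightarrow> 1 / 1) (at 0 within {0..R})"
      using warping_profile_tendsto_ratio[OF s R] warping_profile_tendsto_ratio[OF t R] by (intro tendsto_divide) auto
    moreover have "\<forall>\<^sub>F r in at 0 within {0..R}. s a / t a \<le> (s r / r) / (t r / r)"
      unfolding eventually_at
    proof (intro exI[of _ a] conjI ballI impI)
      fix r assume "r \<in> {0..R}" "r \<noteq> 0 \<and> dist r 0 < a"
      then show "s a / t a \<le> (s r / r) / (t r / r)"
        using mono[of r a] a by auto
    qed (use a in auto)
    moreover have "at 0 within {0..R} \<noteq> bot"
      using R by (simp add: at_within_Icc_at_right trivial_limit_at_right_real)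
    ultimately show ?thesis using tendsto_lowerbound by fastforce
  qed
qed

text \<open>\<open>sin_k k\<close> solves \<open>t'' = - k * t\<close> with value 0 and slope 1 at
  0, whence its constant curvature \<open>k\<close>. For \<open>k > 0\<close> the bound on
  \<open>R\<close> keeps \<open>sqrt k * r\<close> below pi, and so the sine positive.\<close>

lemma warping_profile_sin_k:
  assumes R: "R > 0" and kR: "k > 0 \<Longrightarrow> R < pi / sqrt k"
  shows "warping_profile (sin_k k)
    (\<lambda>r. if k = 0 then 1 else if k > 0 then cos (sqrt k * r) else cosh (sqrt (- k) * r))
    (\<lambda>r. - k * sin_k k r) R"
proof (cases "k = 0")
  case True
  then have "sin_k k = (\<lambda>r. r)" by (simp add: sin_k_def fun_eq_iff)
  then show ?thesis using True by (auto simp: warping_profile_def intro!: derivative_eq_intros)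
next
  case False
  show ?thesis
  proof (cases "k > 0")
    case True
    have "0 < sin (sqrt k * r)" if "0 < r" "r \<le> R" for r
    proof (rule sin_gt_zero)
      show "sqrt k * r < pi" using kR[OF True] that True by (simp add: field_simps) (smt (verit) mult_right_mono real_sqrt_ge_zero)
    qed (use that True in simp)
    moreover have "sin_k k = (\<lambda>r. sin (sqrt k * r) / sqrt k)"
      using True by (simp add: sin_k_def fun_eq_iff)
    moreover have "sqrt k * sqrt k = k" using True by simp
    ultimately show ?thesis using True False
      by (auto simp: warping_profile_def field_simps intro!: derivative_eq_intros)
  next
    case k: False
    define q where "q = sqrt (- k)"
    have q: "q > 0" "k = - (q * q)" using k False by (auto simp: q_def)
    have "sin_k k = (\<lambda>r. sinh (q * r) / q)"
      using k False by (simp add: sin_k_def fun_eq_iff q_def)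
    moreover have "\<not> 0 < - (q * q)" "q * q \<noteq> 0" using q by auto
    ultimately show ?thesis unfolding q(2) q_def[symmetric] using q(1)
      by (auto simp: warping_profile_def field_simps intro!: derivative_eq_intros)
  qed
qed

subsection \<open>Energy densities\<close>

lemma warping_profile_pos: "warping_profile s s1 s2 R \<Longrightarrow> 0 < r \<Longrightarrow> r \<le> R \<Longrightarrow> 0 < s r"
  by (simp add: warping_profile_def)

lemma warping_profile_continuous_on:
  assumes "warping_profile s s1 s2 R"
  shows "continuous_on {0..R} s"
  by (rule DERIV_continuous_on) (use assms in \<open>auto simp: warping_profile_def\<close>)

text \<open>Set to 1 at the origin, \<open>s r / r\<close> is continuous and positive on a compact
  interval, so it attains a positive minimum and a maximum.\<close>

lemma warping_profile_ratio_bounds: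
  assumes s: "warping_profile s s1 s2 R" and R: "R > 0"
  obtains m M where "0 < m" "\<And>r. 0 < r \<Longrightarrow> r \<le> R \<Longrightarrow> m \<le> s r / r \<and> s r / r \<le> M"
proof -
  define q where "q r = (if r = 0 then 1 else s r / r)" for r
  have cont: "continuous_on {0..R} q"
    unfolding continuous_on_def
  proof
    fix r assume r: "r \<in> {0..R}"
    show "(q \<longlongrightarrow> q r) (at r within {0..R})"
    proof (cases "r = 0")
      case True
      have "\<forall>\<^sub>F x in at 0 within {0..R}. s x / x = q x"
        by (auto simp: eventually_at q_def intro: exI[of _ 1])
      then show ?thesis
        using warping_profile_tendsto_ratio[OF s R] True by (auto simp: q_def elim: tendsto_cong[THEN iffD1, rotated])
    next
      case False
      have "((\<lambda>x. s x / x) \<longlongrightarrow> s r / r) (at r within {0..R})"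
        using warping_profile_continuous_on[OF s] r False
        by (auto intro!: tendsto_intros simp: continuous_on_def)
      moreover have "\<forall>\<^sub>F x in at r within {0..R}. s x / x = q x"
        unfolding eventually_at using r False by (auto simp: q_def dist_real_def intro!: exI[of _ r])
      ultimately show ?thesis using False by (auto simp: q_def elim: tendsto_cong[THEN iffD1, rotated])
    qed
  qed
  have ne: "{0..R} \<noteq> {}" using R by simp
  obtain a where a: "a \<in> {0..R}" "\<And>r. r \<in> {0..R} \<Longrightarrow> q a \<le> q r"
    using continuous_attains_inf[OF compact_Icc ne cont] by blast
  obtain b where b: "b \<in> {0..R}" "\<And>r. r \<in> {0..R} \<Longrightarrow> q r \<le> q b"
    using continuous_attains_sup[OF compact_Icc ne cont] by blast
  have "0 < q a" using a(1) warping_profile_pos[OF s, of a] by (auto simp: q_def)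
  moreover have "q a \<le> s r / r \<and> s r / r \<le> q b" if "0 < r" "r \<le> R" for r
    using a(2)[of r] b(2)[of r] that by (simp add: q_def)
  ultimately show ?thesis using that by blast
qed

definition energy_density :: "(real \<Rightarrow> real) \<Rightarrow> (real^'n \<Rightarrow> real^'n) \<Rightarrow> real^'n \<Rightarrow> real" where
  "energy_density s G x = metric_grad_sq s x (G x) * metric_vol_density s x"

lemma radial_component_le: "((x \<bullet> G) / norm x)\<^sup>2 \<le> (norm G)\<^sup>2" for x G :: "real^'n"
proof (cases "x = 0")
  case False
  have "(x \<bullet> G)\<^sup>2 \<le> (norm x)\<^sup>2 * (norm G)\<^sup>2"
    using power_mono[OF Cauchy_Schwarz_ineq2[of x G] abs_ge_zero, of 2]
    by (simp add: power_mult_distrib)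
  then show ?thesis using False by (simp add: power_divide field_simps)
qed simp

text \<open>\<open>P\<close> is the squared radial derivative and
  \<open>(norm (G x))\<^sup>2 - P\<close> the squared Euclidean tangential gradient. The metric
  stretches tangential lengths by \<open>a\<close>, which divides the tangential part by
  \<open>a\<^sup>2\<close> and multiplies volume by \<open>a ^ (CARD('n) - 1)\<close>.\<close>

lemma energy_density_eq:
  fixes x :: "real^'n" and s :: "real \<Rightarrow> real" and G :: "real^'n \<Rightarrow> real^'n"
  assumes "x \<noteq> 0"
  defines "a \<equiv> s (norm x) / norm x" and "P \<equiv> ((x \<bullet> G x) / norm x)\<^sup>2"
  shows "energy_density s G x = (P + ((norm (G x))\<^sup>2 - P) / a\<^sup>2) * a ^ (CARD('n) - 1)"
  unfolding energy_density_def metric_grad_sq_def metric_vol_density_def Let_def a_def P_def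
  by (simp add: algebra_simps diff_divide_distrib)

text \<open>A value produced by division by zero, without geometric meaning; it is the reason why
  lower bounds on the density exclude the origin.\<close>

lemma energy_density_0 [simp]: "energy_density s G 0 = 0"
  by (simp add: energy_density_def metric_grad_sq_def)

text \<open>The stretching factor \<open>s r / r\<close> lies between positive constants, so the
  metric is comparable to the Euclidean one.\<close>

lemma energy_density_bounds:
  fixes G :: "real^'n \<Rightarrow> real^'n"
  assumes s: "warping_profile s s1 s2 R" and R: "R > 0"
  obtains c C where "0 < c" "\<And>G x. x \<in> ball 0 R \<Longrightarrow> 0 \<le> energy_density s G (x::real^'n) \<and> energy_density s G x \<le> C * (norm (G x))\<^sup>2"
    "\<And>G x. x \<in> ball 0 R - {0} \<Longrightarrow> c * (norm (G x))\<^sup>2 \<le> energy_density s G (x::real^'n)"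
proof -
  obtain m M where m: "0 < m" and mM: "\<And>r. 0 < r \<Longrightarrow> r \<le> R \<Longrightarrow> m \<le> s r / r \<and> s r / r \<le> M"
    using warping_profile_ratio_bounds[OF s R] by blast
  have M: "0 < M" using mM[of R] m R by linarith
  define N where "N = CARD('n) - 1"
  \<comment> \<open>The minimum with 1 accounts for the radial part, which is not rescaled;
    \<open>1 / M\<^sup>2\<close> is the least factor on the tangential part.\<close>
  define c where "c = min 1 (1 / M\<^sup>2) * m ^ N"
  define C where "C = (1 + 1 / m\<^sup>2) * M ^ N"
  have *: "c * (norm (G x))\<^sup>2 \<le> energy_density s G x \<and> energy_density s G x \<le> C * (norm (G x))\<^sup>2"
    if x: "x \<in> ball 0 R - {0}" for G and x :: "real^'n"
  proof -
    define a where "a = s (norm x) / norm x"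
    define P where "P = ((x \<bullet> G x) / norm x)\<^sup>2"
    define Q where "Q = (norm (G x))\<^sup>2"
    have a: "m \<le> a" "a \<le> M" using mM[of "norm x"] x by (auto simp: a_def)
    have P: "0 \<le> P" "P \<le> Q" using radial_component_le[of x "G x"] by (auto simp: P_def Q_def)
    have e: "energy_density s G x = (P + (Q - P) / a\<^sup>2) * a ^ N"
      using energy_density_eq[of x s G] x by (simp add: a_def P_def Q_def N_def)
    have aN: "m ^ N \<le> a ^ N" "a ^ N \<le> M ^ N" using a m by (auto intro!: power_mono)
    have ia: "1 / M\<^sup>2 \<le> 1 / a\<^sup>2" "1 / a\<^sup>2 \<le> 1 / m\<^sup>2"
      using a m by (auto intro!: divide_left_mono power_mono mult_pos_pos)
    have "min 1 (1 / M\<^sup>2) * P + min 1 (1 / M\<^sup>2) * (Q - P) \<le> 1 * P + (1 / a\<^sup>2) * (Q - P)"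
      using P ia by (intro add_mono mult_right_mono) auto
    then have lo: "min 1 (1 / M\<^sup>2) * Q \<le> P + (Q - P) / a\<^sup>2" by (simp add: algebra_simps)
    have "1 * P + (1 / a\<^sup>2) * (Q - P) \<le> 1 * Q + (1 / m\<^sup>2) * Q"
      using P ia by (intro add_mono mult_mono) auto
    then have hi: "P + (Q - P) / a\<^sup>2 \<le> (1 + 1 / m\<^sup>2) * Q" by (simp add: algebra_simps)
    have "min 1 (1 / M\<^sup>2) * Q * m ^ N \<le> (P + (Q - P) / a\<^sup>2) * a ^ N"
      using lo aN P m by (intro mult_mono) auto
    moreover have "(P + (Q - P) / a\<^sup>2) * a ^ N \<le> (1 + 1 / m\<^sup>2) * Q * M ^ N"
      using hi aN P m a by (intro mult_mono) auto
    ultimately show ?thesis unfolding e c_def C_def Q_def[symmetric] by (simp add: mult_ac)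
  qed
  have c: "0 < c" using m M by (simp add: c_def)
  have "0 \<le> C" using m M by (simp add: C_def)
  show ?thesis
  proof (rule that[OF c])
    fix G and x :: "real^'n" assume x: "x \<in> ball 0 R"
    show "0 \<le> energy_density s G x \<and> energy_density s G x \<le> C * (norm (G x))\<^sup>2"
    proof (cases "x = 0")
      case False
      have "0 \<le> c * (norm (G x))\<^sup>2" using c by simp
      then show ?thesis using *[of x G] x False by force
    qed (use \<open>0 \<le> C\<close> in simp)
  qed (use * in blast)
qed

text \<open>Integrability comes from boundedness and measurability. Continuity is not at hand at the
  origin, where the density is 0 by convention.\<close>

lemma energy_density_integrable:
  fixes u :: "real^'n \<Rightarrow> real"
  assumes s: "warping_profile s s1 s2 R" and R: "R > 0" and C1: "C1_cball_grad R u G"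
  shows "energy_density s G integrable_on ball 0 R"
proof -
  \<comment> \<open>\<open>s\<close> and \<open>G\<close> are controlled only on
    \<open>{0..R}\<close> and on the closed ball; cutting them off makes the density Borel
    everywhere and leaves it unchanged on the ball.\<close>
  define s' where "s' r = indicator {0..R} r *\<^sub>R s r" for r
  define G' where "G' x = indicator (cball 0 R) x *\<^sub>R G x" for x
  have [measurable]: "s' \<in> borel_measurable borel" "G' \<in> borel_measurable borel"
    unfolding s'_def G'_def
    by (rule borel_measurable_continuous_on_indicator;
        use warping_profile_continuous_on[OF s] C1_cball_grad_continuous_on(2)[OF C1] in simp)+
  have eq: "energy_density s G x = energy_density s' G' x" if "x \<in> ball 0 R" for x
    using that by (simp add: energy_density_def metric_grad_sq_def metric_vol_density_def s'_def G'_def)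
  obtain M where M: "0 \<le> M" "\<And>x. x \<in> cball 0 R \<Longrightarrow> norm (G x) \<le> M"
    using continuous_on_cball_bounded[OF C1_cball_grad_continuous_on(2)[OF C1]] by blast
  obtain c C where C: "\<And>G x. x \<in> ball 0 R \<Longrightarrow> 0 \<le> energy_density s G (x::real^'n) \<and> energy_density s G x \<le> C * (norm (G x))\<^sup>2"
    using energy_density_bounds[OF s R, where 'n='n] by metis
  have "set_integrable lborel (ball 0 R) (energy_density s' G')"
  proof (rule set_integrable_bounded[where M="\<bar>C\<bar> * M\<^sup>2"])
    show "energy_density s' G' \<in> borel_measurable borel"
      unfolding energy_density_def metric_grad_sq_def metric_vol_density_def Let_def by measurable
    fix x :: "real^'n" assume x: "x \<in> ball 0 R"
    have "C * (norm (G x))\<^sup>2 \<le> \<bar>C\<bar> * M\<^sup>2"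
      using M x by (intro mult_mono power_mono) auto
    then show "\<bar>energy_density s' G' x\<bar> \<le> \<bar>C\<bar> * M\<^sup>2"
      using C[OF x, of G] eq[OF x] by auto
  qed auto
  then have "energy_density s' G' integrable_on ball 0 R"
    by (rule set_borel_integral_eq_integral)
  then show ?thesis
    by (rule integrable_eq) (rule eq[symmetric])
qed

lemma dirichlet_energy_eq: "dirichlet_energy s R G = integral (ball 0 R) (energy_density s G)"
  by (simp add: dirichlet_energy_def energy_density_def[abs_def])

text \<open>In terms of \<open>a\<close> and \<open>b\<close> the hypotheses read
  \<open>a \<le> b\<close> and \<open>b * s R \<le> a * t R\<close>. In the first inequality the
  boundary powers merge with the volume factors, while the bracket \<open>P + Q / a\<^sup>2\<close>
  grows as \<open>a\<close> shrinks. In the second, radial and tangential parts are compared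
  separately.\<close>

lemma energy_density_compare:
  fixes x :: "real^'n"
  assumes n2: "CARD('n) \<ge> 2" and x: "x \<in> ball 0 R" and R: "R > 0"
    and s: "warping_profile s s1 s2 R" and t: "warping_profile t t1 t2 R"
    and mono: "\<And>a. 0 < a \<Longrightarrow> a \<le> R \<Longrightarrow> s R / t R \<le> s a / t a"
    and le1: "\<And>a. 0 < a \<Longrightarrow> a \<le> R \<Longrightarrow> s a / t a \<le> 1"
  shows "energy_density t G x * s R ^ (CARD('n) - 1) \<le> energy_density s G x * t R ^ (CARD('n) - 1)"
    and "energy_density s G x * (s R)\<^sup>2 \<le> energy_density t G x * (t R)\<^sup>2"
proof -
  define a b where "a = s (norm x) / norm x" and "b = t (norm x) / norm x"
  define P where "P = ((x \<bullet> G x) / norm x)\<^sup>2"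
  define Q where "Q = (norm (G x))\<^sup>2 - P"
  obtain N where N: "CARD('n) - 1 = Suc N" using n2 by (cases "CARD('n) - 1") auto
  have PQ: "0 \<le> P" "0 \<le> Q" using radial_component_le[of x "G x"] by (auto simp: P_def Q_def)
  have sR: "0 < s R" and tR: "0 < t R" using warping_profile_pos[OF s] warping_profile_pos[OF t] R by auto
  have st: "s R \<le> t R" using le1[of R] R tR by simp
  have "energy_density t G x * s R ^ (CARD('n) - 1) \<le> energy_density s G x * t R ^ (CARD('n) - 1) \<and>
    energy_density s G x * (s R)\<^sup>2 \<le> energy_density t G x * (t R)\<^sup>2"
  proof (cases "x = 0")
    case False
    have r: "0 < norm x" "norm x \<le> R" using False x by auto
    have pos: "0 < s (norm x)" "0 < t (norm x)" using warping_profile_pos[OF s r] warping_profile_pos[OF t r] by auto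
    have ab: "0 < a" "0 < b" "a \<le> b" "b * s R \<le> a * t R"
    proof -
      show "0 < a" "0 < b" using pos r by (auto simp: a_def b_def)
      show "a \<le> b" using le1[OF r] pos r by (simp add: a_def b_def divide_right_mono)
      have "s R * t (norm x) \<le> s (norm x) * t R" using mono[OF r] pos tR by (simp add: field_simps)
      then show "b * s R \<le> a * t R" using r by (simp add: a_def b_def field_simps)
    qed
    have es: "energy_density s G x = (P + Q / a\<^sup>2) * a ^ Suc N"
      using energy_density_eq[OF False, of s G] unfolding a_def P_def Q_def N .
    have et: "energy_density t G x = (P + Q / b\<^sup>2) * b ^ Suc N"
      using energy_density_eq[OF False, of t G] unfolding b_def P_def Q_def N .
    have "(P + Q / b\<^sup>2) * (b * s R) ^ Suc N \<le> (P + Q / a\<^sup>2) * (a * t R) ^ Suc N"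
    proof (rule mult_mono)
      show "(b * s R) ^ Suc N \<le> (a * t R) ^ Suc N"
        using ab sR by (intro power_mono[OF ab(4)]) auto
      show "P + Q / b\<^sup>2 \<le> P + Q / a\<^sup>2"
        using ab PQ by (intro add_left_mono divide_left_mono power_mono mult_pos_pos) auto
    qed (use ab PQ sR in auto)
    then have 1: "energy_density t G x * s R ^ Suc N \<le> energy_density s G x * t R ^ Suc N"
      unfolding es et by (simp add: power_mult_distrib mult_ac)
    have aN: "a ^ N \<le> b ^ N" using ab by (intro power_mono) auto
    have 2: "a ^ Suc N * (s R)\<^sup>2 \<le> b ^ Suc N * (t R)\<^sup>2"
      using ab st sR by (intro mult_mono power_mono) auto
    \<comment> \<open>The tangential part carries \<open>a ^ N / a\<close>, whose inverse factor
      goes the wrong way. Paired with one of the two factors \<open>s R\<close> it becomes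
      \<open>s R / a\<close>, which monotonicity of the ratio bounds by \<open>t R / b\<close>; the
      remaining exponent \<open>N\<close>, the dimension minus 2, is nonnegative.\<close>
    have "s R / a \<le> t R / b" using ab by (simp add: field_simps)
    then have "s R / a * s R \<le> t R / b * t R"
      using ab st sR by (intro mult_mono) auto
    then have 3: "a ^ N * (s R / a * s R) \<le> b ^ N * (t R / b * t R)"
      by (rule mult_mono[OF aN]) (use ab sR in auto)
    have "P * (a ^ Suc N * (s R)\<^sup>2) + Q * (a ^ N * (s R / a * s R)) \<le> P * (b ^ Suc N * (t R)\<^sup>2) + Q * (b ^ N * (t R / b * t R))"
      using 2 3 PQ by (intro add_mono mult_left_mono) auto
    moreover have "energy_density s G x * (s R)\<^sup>2 = P * (a ^ Suc N * (s R)\<^sup>2) + Q * (a ^ N * (s R / a * s R))"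
      unfolding es using ab by (simp add: field_simps power2_eq_square)
    moreover have "energy_density t G x * (t R)\<^sup>2 = P * (b ^ Suc N * (t R)\<^sup>2) + Q * (b ^ N * (t R / b * t R))"
      unfolding et using ab by (simp add: field_simps power2_eq_square)
    ultimately show ?thesis using 1 N by simp
  qed simp
  then show "energy_density t G x * s R ^ (CARD('n) - 1) \<le> energy_density s G x * t R ^ (CARD('n) - 1)"
    "energy_density s G x * (s R)\<^sup>2 \<le> energy_density t G x * (t R)\<^sup>2" by blast+
qed

subsection \<open>Comparison of Steklov eigenvalues\<close>

definition test_functions :: "real \<Rightarrow> ((real^'n \<Rightarrow> real) \<times> (real^'n \<Rightarrow> real^'n)) set" where
  "test_functions R = {(u, G). C1_cball_grad R u G \<and> unit_sphere_integral (\<lambda>w. u (R *\<^sub>R w)) = 0 \<and>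
     unit_sphere_integral (\<lambda>w. (u (R *\<^sub>R w))\<^sup>2) \<noteq> 0}"

definition steklov_quotient :: "(real \<Rightarrow> real) \<Rightarrow> real \<Rightarrow> (real^'n \<Rightarrow> real) \<times> (real^'n \<Rightarrow> real^'n) \<Rightarrow> real" where
  "steklov_quotient s R = (\<lambda>(u, G). dirichlet_energy s R G /
     (s R ^ (CARD('n) - 1) * unit_sphere_integral (\<lambda>w. (u (R *\<^sub>R w))\<^sup>2)))"

text \<open>The boundary factor \<open>s R ^ (CARD('n) - 1)\<close> is nonzero and cancels from both
  side conditions, which leaves an index set free of \<open>s\<close>.\<close>

lemma steklov_mu1_eq_INF:
  assumes "s R \<noteq> 0"
  shows "steklov_mu1 s R (T :: 'n::finite itself) =
    (INF p\<in>(test_functions R :: ((real^'n \<Rightarrow> real) \<times> (real^'n \<Rightarrow> real^'n)) set). steklov_quotient s R p)"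
proof -
  have "{dirichlet_energy s R G / boundary_integral s R (\<lambda>x. (u x)^2) | u G.
       C1_cball_grad R (u :: real^'n \<Rightarrow> real) G \<and> boundary_integral s R u = 0 \<and>
       boundary_integral s R (\<lambda>x. (u x)^2) \<noteq> 0} =
       steklov_quotient s R ` (test_functions R :: ((real^'n \<Rightarrow> real) \<times> (real^'n \<Rightarrow> real^'n)) set)"
    using assms by (auto simp: boundary_integral_def test_functions_def steklov_quotient_def image_iff)
  then show ?thesis by (simp add: steklov_mu1_def)
qed

lemma test_functions_nonempty: "R > 0 \<Longrightarrow> test_functions R \<noteq> {}"
  using exists_coordinate_test_function[of R] unfolding test_functions_def by auto

lemma test_functions_boundary_pos:
  assumes "(u, G) \<in> test_functions R"
  shows "0 < unit_sphere_integral (\<lambda>w. (u (R *\<^sub>R w))\<^sup>2)"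
  using assms integral_nonneg'[of "ball 0 1" "\<lambda>x. (u (R *\<^sub>R (x /\<^sub>R norm x)))\<^sup>2"]
  unfolding test_functions_def unit_sphere_integral_def
  by (auto simp: less_le simp del: scaleR_scaleR)

lemma steklov_quotient_nonneg:
  fixes p :: "(real^'n \<Rightarrow> real) \<times> (real^'n \<Rightarrow> real^'n)"
  assumes s: "warping_profile s s1 s2 R" and R: "R > 0" and p: "p \<in> test_functions R"
  shows "0 \<le> steklov_quotient s R p"
proof -
  obtain u G where [simp]: "p = (u, G)" by fastforce
  have "\<And>x. x \<in> ball 0 R \<Longrightarrow> 0 \<le> energy_density s G x"
    using energy_density_bounds[OF s R, where 'n='n] by metis
  then have "0 \<le> dirichlet_energy s R G" unfolding dirichlet_energy_eq by (rule integral_nonneg')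
  then show ?thesis
    using test_functions_boundary_pos[of u G R] p warping_profile_pos[OF s R order_refl]
    by (simp add: steklov_quotient_def)
qed

lemma bdd_below_steklov_quotient:
  assumes "warping_profile s s1 s2 R" "R > 0"
  shows "bdd_below (steklov_quotient s R ` (test_functions R :: ((real^'n \<Rightarrow> real) \<times> (real^'n \<Rightarrow> real^'n)) set))"
  by (rule bdd_belowI2[where m=0]) (rule steklov_quotient_nonneg[OF assms])

lemma dirichlet_energy_compare:
  fixes u :: "real^'n \<Rightarrow> real"
  assumes n2: "CARD('n) \<ge> 2" and R: "R > 0" and C1: "C1_cball_grad R u G"
    and s: "warping_profile s s1 s2 R" and t: "warping_profile t t1 t2 R"
    and curv: "\<And>r. r \<in> {0<..R} \<Longrightarrow> s2 r / s r \<le> t2 r / t r"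
  shows "dirichlet_energy t R G * s R ^ (CARD('n) - 1) \<le> dirichlet_energy s R G * t R ^ (CARD('n) - 1)"
    and "dirichlet_energy s R G * (s R)\<^sup>2 \<le> dirichlet_energy t R G * (t R)\<^sup>2"
proof -
  note ratio = warping_ratio_antimono[OF s t curv]
  note int = energy_density_integrable[OF s R C1] energy_density_integrable[OF t R C1]
  have *: "integral (ball 0 R) f * a \<le> integral (ball 0 R) g * b"
    if "f integrable_on ball 0 R" "g integrable_on ball 0 R" "\<And>x. x \<in> ball 0 R \<Longrightarrow> f x * a \<le> g x * b"
    for f g :: "real^'n \<Rightarrow> real" and a b
    unfolding integral_mult_left[symmetric] using that by (intro integral_le integrable_on_mult_left) auto
  show "dirichlet_energy t R G * s R ^ (CARD('n) - 1) \<le> dirichlet_energy s R G * t R ^ (CARD('n) - 1)"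
    unfolding dirichlet_energy_eq
    by (intro * int energy_density_compare(1)[OF n2 _ R s t]) (use ratio R in auto)
  show "dirichlet_energy s R G * (s R)\<^sup>2 \<le> dirichlet_energy t R G * (t R)\<^sup>2"
    unfolding dirichlet_energy_eq
    by (intro * int energy_density_compare(2)[OF n2 _ R s t]) (use ratio R in auto)
qed

lemma steklov_mu1_compare:
  fixes T :: "'n::finite itself"
  assumes n2: "CARD('n) \<ge> 2" and R: "R > 0"
    and s: "warping_profile s s1 s2 R" and t: "warping_profile t t1 t2 R"
    and curv: "\<And>r. r \<in> {0<..R} \<Longrightarrow> s2 r / s r \<le> t2 r / t r"
  shows "steklov_mu1 t R T \<le> steklov_mu1 s R T"
    and "steklov_mu1 s R T \<le> (t R / s R) ^ (CARD('n) + 1) * steklov_mu1 t R T"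
proof -
  have sR: "0 < s R" and tR: "0 < t R" using warping_profile_pos[OF s] warping_profile_pos[OF t] R by auto
  define A where "A = (test_functions R :: ((real^'n \<Rightarrow> real) \<times> (real^'n \<Rightarrow> real^'n)) set)"
  define c where "c = (t R / s R) ^ (CARD('n) + 1)"
  have c: "c > 0" using sR tR by (simp add: c_def)
  have A: "A \<noteq> {}" using test_functions_nonempty[OF R] by (simp add: A_def)
  have bdd: "bdd_below (steklov_quotient s R ` A)" "bdd_below (steklov_quotient t R ` A)"
    unfolding A_def by (intro bdd_below_steklov_quotient[OF s R] bdd_below_steklov_quotient[OF t R])+
  have mu: "steklov_mu1 s R T = (INF p\<in>A. steklov_quotient s R p)"
    "steklov_mu1 t R T = (INF p\<in>A. steklov_quotient t R p)"
    unfolding A_def using sR tR by (intro steklov_mu1_eq_INF; simp)+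
  have q: "steklov_quotient t R p \<le> steklov_quotient s R p \<and>
      steklov_quotient s R p \<le> c * steklov_quotient t R p" if p: "p \<in> A" for p
  proof -
    obtain u G where pe [simp]: "p = (u, G)" by fastforce
    define J where "J = unit_sphere_integral (\<lambda>w. (u (R *\<^sub>R w))\<^sup>2)"
    define S where "S = dirichlet_energy s R G"
    define E where "E = dirichlet_energy t R G"
    obtain N where N: "CARD('n) = Suc N" using n2 by (cases "CARD('n)") auto
    have C1: "C1_cball_grad R u G" and J: "J > 0"
      using p test_functions_boundary_pos[of u G R] by (auto simp: A_def test_functions_def J_def)
    note cmp = dirichlet_energy_compare[OF n2 R C1 s t curv, folded S_def E_def, unfolded N diff_Suc_1]
    have "E / (t R ^ N * J) \<le> S / (s R ^ N * J)"
      using cmp(1) sR tR J by (simp add: divide_simps mult_ac)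
    moreover have "S / (s R ^ N * J) \<le> c * (E / (t R ^ N * J))"
    proof -
      have "S \<le> E * (t R)\<^sup>2 / (s R)\<^sup>2" using cmp(2) sR by (simp add: field_simps)
      then have "S / (s R ^ N * J) \<le> (E * (t R)\<^sup>2 / (s R)\<^sup>2) / (s R ^ N * J)"
        using sR J by (intro divide_right_mono) auto
      \<comment> \<open>The exponents add up: 2 from the energies and
        \<open>N = CARD('n) - 1\<close> from the boundary factors.\<close>
      also have "\<dots> = c * (E / (t R ^ N * J))"
        using sR tR J by (simp add: c_def N power_divide field_simps power2_eq_square)
      finally show ?thesis .
    qed
    ultimately show ?thesis by (simp add: steklov_quotient_def S_def E_def J_def N)
  qed
  show "steklov_mu1 t R T \<le> steklov_mu1 s R T"
    unfolding mu by (rule cINF_mono[OF A bdd(2)]) (use q in blast)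
  \<comment> \<open>Dividing by \<open>c\<close> turns the claim into a lower bound for an
    infimum.\<close>
  have "steklov_mu1 s R T / c \<le> steklov_mu1 t R T"
    unfolding mu(2)
  proof (rule cINF_greatest[OF A])
    fix p assume p: "p \<in> A"
    have "steklov_mu1 s R T \<le> steklov_quotient s R p"
      unfolding mu by (rule cINF_lower[OF bdd(1) p])
    then show "steklov_mu1 s R T / c \<le> steklov_quotient t R p"
      using q[OF p] c by (simp add: field_simps)
  qed
  then have "steklov_mu1 s R T \<le> c * steklov_mu1 t R T"
    using c by (simp add: field_simps)
  then show "steklov_mu1 s R T \<le> (t R / s R) ^ (CARD('n) + 1) * steklov_mu1 t R T"
    unfolding c_def .
qed

text \<open>The trace inequality bounds the boundary integral by the Euclidean Dirichlet integral,
  and the latter is bounded by the energy in the metric. The resulting \<open>\<delta>\<close> does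
  not depend on the test function, so it survives the infimum.\<close>

lemma steklov_mu1_pos:
  fixes T :: "'n::finite itself"
  assumes s: "warping_profile s s1 s2 R" and R: "R > 0"
  shows "0 < steklov_mu1 s R T"
proof -
  have sR: "0 < s R" using warping_profile_pos[OF s] R by auto
  obtain c C where c: "0 < c" and lower: "\<And>G x. x \<in> ball 0 R - {0} \<Longrightarrow> c * (norm (G x))\<^sup>2 \<le> energy_density s G (x::real^'n)"
    using energy_density_bounds[OF s R, where 'n='n] by metis
  obtain K where K: "K > 0" and trace:
    "\<And>(u :: real^'n \<Rightarrow> real) G. C1_cball_grad R u G \<Longrightarrow> unit_sphere_integral (\<lambda>w. u (R *\<^sub>R w)) = 0 \<Longrightarrow>
      unit_sphere_integral (\<lambda>w. (u (R *\<^sub>R w))\<^sup>2) \<le> K * integral (ball 0 R) (\<lambda>x. (norm (G x))\<^sup>2)"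
    using trace_poincare[OF R] by metis
  define \<delta> where "\<delta> = c / (K * s R ^ (CARD('n) - 1))"
  have "\<delta> \<le> (INF p\<in>(test_functions R :: ((real^'n \<Rightarrow> real) \<times> (real^'n \<Rightarrow> real^'n)) set). steklov_quotient s R p)"
  proof (rule cINF_greatest[OF test_functions_nonempty[OF R]])
    fix p :: "(real^'n \<Rightarrow> real) \<times> (real^'n \<Rightarrow> real^'n)" assume p: "p \<in> test_functions R"
    obtain u G where pe [simp]: "p = (u, G)" by fastforce
    define J where "J = unit_sphere_integral (\<lambda>w. (u (R *\<^sub>R w))\<^sup>2)"
    define I where "I = integral (ball 0 R) (\<lambda>x. (norm (G x))\<^sup>2)"
    have C1: "C1_cball_grad R u G" and J: "J > 0"
      using p test_functions_boundary_pos[of u G R] by (auto simp: test_functions_def J_def)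
    have JI: "J \<le> K * I" using trace[OF C1] p by (simp add: J_def I_def test_functions_def)
    have "continuous_on (cball 0 R) (\<lambda>x. (norm (G x))\<^sup>2)"
      using C1_cball_grad_continuous_on(2)[OF C1] by (intro continuous_intros)
    then have "set_integrable lborel (cball 0 R) (\<lambda>x. (norm (G x))\<^sup>2)"
      unfolding set_integrable_def by (intro borel_integrable_compact compact_cball)
    then have "set_integrable lborel (ball 0 R) (\<lambda>x. (norm (G x))\<^sup>2)"
      by (rule set_integrable_subset) auto
    then have int: "(\<lambda>x. (norm (G x))\<^sup>2) integrable_on ball 0 R"
      by (rule set_borel_integral_eq_integral)
    have "c * I = integral (ball 0 R) (\<lambda>x. c * (norm (G x))\<^sup>2)"
      by (simp add: I_def)
    \<comment> \<open>The pointwise lower bound may fail at the origin, a null set, so the integrand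
      is altered there.\<close>
    also have "\<dots> = integral (ball 0 R) (\<lambda>x. if x = 0 then 0 else c * (norm (G x))\<^sup>2)"
      by (rule integral_spike[of "{0}"]) auto
    also have "\<dots> \<le> dirichlet_energy s R G"
      unfolding dirichlet_energy_eq
    proof (rule integral_le)
      show "(\<lambda>x. if x = 0 then 0 else c * (norm (G x))\<^sup>2) integrable_on ball 0 R"
        by (rule integrable_spike[OF integrable_on_mult_right[OF int, of c], of "{0}"]) auto
      show "energy_density s G integrable_on ball 0 R" by (rule energy_density_integrable[OF s R C1])
      show "(if x = 0 then 0 else c * (norm (G x))\<^sup>2) \<le> energy_density s G x" if "x \<in> ball 0 R" for x
        using lower[of x G] that by auto
    qed
    finally have cI: "c * I \<le> dirichlet_energy s R G" .
    have "\<delta> * (s R ^ (CARD('n) - 1) * J) = c * (J / K)"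
      using sR K by (simp add: \<delta>_def)
    also have "\<dots> \<le> c * I" using JI K c by (intro mult_left_mono) (auto simp: field_simps)
    finally have "\<delta> * (s R ^ (CARD('n) - 1) * J) \<le> dirichlet_energy s R G" using cI by linarith
    then show "\<delta> \<le> steklov_quotient s R p"
      using sR J by (simp add: steklov_quotient_def J_def[symmetric] pos_le_divide_eq)
  qed
  moreover have "0 < \<delta>" using c K sR by (simp add: \<delta>_def)
  ultimately show ?thesis using sR by (subst steklov_mu1_eq_INF) auto
qed

lemma steklov_mu1_cong:
  fixes T :: "'n::finite itself"
  assumes R: "R > 0" and eq: "\<And>r. r \<in> {0..R} \<Longrightarrow> s r = t r"
  shows "steklov_mu1 s R T = steklov_mu1 t R T"
proof -
  have "dirichlet_energy s R G = dirichlet_energy t R G" for G :: "real^'n \<Rightarrow> real^'n"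
    unfolding dirichlet_energy_eq
    by (rule integral_cong) (simp add: eq energy_density_def metric_grad_sq_def metric_vol_density_def)
  moreover have "boundary_integral s R f = boundary_integral t R f" for f :: "real^'n \<Rightarrow> real"
    using R by (simp add: boundary_integral_def eq)
  ultimately show ?thesis by (simp add: steklov_mu1_def)
qed

text \<open>The ratio \<open>s / t\<close> is nonincreasing, at most 1, and equal to 1 at
  \<open>R\<close>, so it is 1 throughout.\<close>

lemma warping_ratio_rigidity:
  assumes R: "R > 0" and s: "warping_profile s s1 s2 R" and t: "warping_profile t t1 t2 R"
    and curv: "\<And>r. r \<in> {0<..R} \<Longrightarrow> s2 r / s r \<le> t2 r / t r"
    and eq: "s R = t R" and r: "r \<in> {0..R}"
  shows "s r = t r"
proof (cases "r = 0")
  case False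
  then have r': "0 < r" "r \<le> R" using r by auto
  have "1 \<le> s r / t r"
    using warping_ratio_antimono(1)[OF s t curv r'(1) r'(2) order_refl] eq warping_profile_pos[OF t R] by simp
  then show ?thesis
    using warping_ratio_antimono(2)[OF s t curv r'] warping_profile_pos[OF t r'] by (simp add: field_simps)
qed (use s t in \<open>simp add: warping_profile_def\<close>)

theorem theorem3p2:
  fixes \<sigma> :: "real \<Rightarrow> real" and D :: "nat \<Rightarrow> real \<Rightarrow> real"
    and R k :: real and n_ty :: "'n::finite itself"
  assumes n2: "CARD('n) \<ge> 2"
    and Rpos: "R > 0"
    and D0: "D 0 = \<sigma>"
    and smooth: "\<And>m t. t \<in> {0..R} \<Longrightarrow> (D m has_real_derivative D (Suc m) t) (at t within {0..R})"
    and s0: "\<sigma> 0 = 0" and s'0: "D 1 0 = 1"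
    and spos: "\<And>r. r \<in> {0<..R} \<Longrightarrow> \<sigma> r > 0"
    and kR: "k > 0 \<Longrightarrow> R < pi / sqrt k"
  shows
    "((\<forall>r\<in>{0<..R}. - D 2 r / \<sigma> r \<ge> k) \<longrightarrow>
        steklov_mu1 (sin_k k) R n_ty \<le> steklov_mu1 \<sigma> R n_ty \<and>
        steklov_mu1 \<sigma> R n_ty \<le> (sin_k k R / \<sigma> R) ^ (CARD('n) + 1) * steklov_mu1 (sin_k k) R n_ty)
   \<and> ((\<forall>r\<in>{0<..R}. - D 2 r / \<sigma> r \<le> k) \<longrightarrow>
        (sin_k k R / \<sigma> R) ^ (CARD('n) + 1) * steklov_mu1 (sin_k k) R n_ty \<le> steklov_mu1 \<sigma> R n_ty \<and>
        steklov_mu1 \<sigma> R n_ty \<le> steklov_mu1 (sin_k k) R n_ty)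
   \<and> (((\<forall>r\<in>{0<..R}. - D 2 r / \<sigma> r \<ge> k) \<or> (\<forall>r\<in>{0<..R}. - D 2 r / \<sigma> r \<le> k)) \<longrightarrow>
        ((steklov_mu1 (sin_k k) R n_ty = steklov_mu1 \<sigma> R n_ty \<and>
          steklov_mu1 \<sigma> R n_ty = (sin_k k R / \<sigma> R) ^ (CARD('n) + 1) * steklov_mu1 (sin_k k) R n_ty)
         \<longleftrightarrow> (\<forall>r\<in>{0..R}. \<sigma> r = sin_k k r)))"
proof -
  have \<sigma>: "warping_profile \<sigma> (D 1) (D 2) R"
    using smooth[of _ 0] smooth[of _ 1] s0 s'0 spos by (simp add: warping_profile_def D0 numeral_2_eq_2)
  note S = warping_profile_sin_k[OF Rpos kR]
  have SR: "0 < sin_k k R" and \<sigma>R: "0 < \<sigma> R"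
    using warping_profile_pos[OF S] warping_profile_pos[OF \<sigma>] Rpos by auto
  have Sk: "- k * sin_k k r / sin_k k r = - k" if "r \<in> {0<..R}" for r
    using warping_profile_pos[OF S, of r] that by simp
  have ge: "D 2 r / \<sigma> r \<le> - k * sin_k k r / sin_k k r"
    if "\<forall>r\<in>{0<..R}. - D 2 r / \<sigma> r \<ge> k" "r \<in> {0<..R}" for r
    using bspec[OF that] Sk[OF that(2)] by simp
  have le: "- k * sin_k k r / sin_k k r \<le> D 2 r / \<sigma> r"
    if "\<forall>r\<in>{0<..R}. - D 2 r / \<sigma> r \<le> k" "r \<in> {0<..R}" for r
    using bspec[OF that] Sk[OF that(2)] by simp
  define \<mu>\<sigma> where "\<mu>\<sigma> = steklov_mu1 \<sigma> R n_ty"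
  define \<mu>S where "\<mu>S = steklov_mu1 (sin_k k) R n_ty"
  define c where "c = (sin_k k R / \<sigma> R) ^ (CARD('n) + 1)"
  have c: "c > 0" using SR \<sigma>R by (simp add: c_def)
  \<comment> \<open>With the profiles exchanged the comparison yields the reciprocal factor;
    multiplying by \<open>c\<close> gives the bound of the second case.\<close>
  have ic: "(\<sigma> R / sin_k k R) ^ (CARD('n) + 1) = 1 / c"
    by (simp only: c_def power_divide) simp
  have 1: "\<mu>S \<le> \<mu>\<sigma> \<and> \<mu>\<sigma> \<le> c * \<mu>S" if "\<forall>r\<in>{0<..R}. - D 2 r / \<sigma> r \<ge> k"
    using steklov_mu1_compare[OF n2 Rpos \<sigma> S ge[OF that], of n_ty] by (simp add: \<mu>\<sigma>_def \<mu>S_def c_def)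
  have 2: "c * \<mu>S \<le> \<mu>\<sigma> \<and> \<mu>\<sigma> \<le> \<mu>S" if "\<forall>r\<in>{0<..R}. - D 2 r / \<sigma> r \<le> k"
    using steklov_mu1_compare[OF n2 Rpos S \<sigma> le[OF that], of n_ty] c unfolding ic
    by (simp add: \<mu>\<sigma>_def \<mu>S_def field_simps)
  have 3: "(\<mu>S = \<mu>\<sigma> \<and> \<mu>\<sigma> = c * \<mu>S) \<longleftrightarrow> (\<forall>r\<in>{0..R}. \<sigma> r = sin_k k r)"
    if K: "(\<forall>r\<in>{0<..R}. - D 2 r / \<sigma> r \<ge> k) \<or> (\<forall>r\<in>{0<..R}. - D 2 r / \<sigma> r \<le> k)"
  proof
    assume "\<mu>S = \<mu>\<sigma> \<and> \<mu>\<sigma> = c * \<mu>S"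
    then have "1 * \<mu>S = c * \<mu>S" by (metis mult_1)
    \<comment> \<open>Positivity is what allows \<open>\<mu>S\<close> to be cancelled from
      \<open>\<mu>S = c * \<mu>S\<close>.\<close>
    moreover have "0 < \<mu>S" unfolding \<mu>S_def by (rule steklov_mu1_pos[OF S Rpos])
    ultimately have "c = 1" unfolding mult_cancel_right by linarith
    then have "(sin_k k R / \<sigma> R) ^ (CARD('n) + 1) = 1 ^ (CARD('n) + 1)" by (simp add: c_def)
    then have "sin_k k R / \<sigma> R = 1"
      by (rule power_eq_imp_eq_base) (use SR \<sigma>R in simp_all)
    then have eq: "\<sigma> R = sin_k k R" using \<sigma>R by simp
    show "\<forall>r\<in>{0..R}. \<sigma> r = sin_k k r"
      using K
    proof
      assume *: "\<forall>r\<in>{0<..R}. - D 2 r / \<sigma> r \<ge> k"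
      show ?thesis using warping_ratio_rigidity[OF Rpos \<sigma> S ge[OF *] eq] by blast
    next
      assume *: "\<forall>r\<in>{0<..R}. - D 2 r / \<sigma> r \<le> k"
      show ?thesis using warping_ratio_rigidity[OF Rpos S \<sigma> le[OF *] eq[symmetric]] by auto
    qed
  next
    assume *: "\<forall>r\<in>{0..R}. \<sigma> r = sin_k k r"
    then have "\<mu>\<sigma> = \<mu>S" unfolding \<mu>\<sigma>_def \<mu>S_def by (intro steklov_mu1_cong[OF Rpos]) auto
    moreover have "c = 1" using * Rpos SR by (simp add: c_def)
    ultimately show "\<mu>S = \<mu>\<sigma> \<and> \<mu>\<sigma> = c * \<mu>S" by simp
  qed
  show ?thesis
    using 1 2 3 unfolding \<mu>\<sigma>_def \<mu>S_def c_def by blast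
qed

end
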